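(* There exists a canonical routing labeling scheme for rooted trees on $n$ nodes with labels of length $\log n+\mathcal{O}\big((\log n)^{3/4}\sqrt{\log\log n}\big)$ bits.
   Context: All logarithms are base $2$. A (designer-port) routing labeling scheme for a family $\mathcal{T}$ of rooted trees consists of an encoder and a decoder. - The encoder is given $T\in\mathcal{T}$. It assigns a binary string (label) $\ell(u)$ to every node $u$. It also labels the edges from each node $u$ to its $\deg(u)$ children with distinct port numbers from $\{1,\dots,\deg(u)\}$; the encoder is free to choose these port numbers. - The decoder receives only $\ell(u)$ and $\ell(w)$ for nodes $u\neq w$ of some $T\in\mathcal{T}$; the value $\lceil\log n\rceil$, where $n=|T|$, may also be assumed known. It must return $0$ if the next node on the path from $u$ to $w$ is the parent of $u$. Otherwise it must return the port number of the first edge on that path. - The length of the scheme is the maximum label length over all trees in $\mathcal{T}$ and all their nodes. A port assignment is canonical if, for every node $v$ with children $v_1,\dots,v_i$ ordered so that $|T_{v_1}|\ge\dots\ge|T_{v_i}|$, the edge from $v$ to $v_j$ gets port $j$. Here $T_v$ denotes the subtree rooted at $v$; ties may be broken arbitrarily. A scheme is canonical if its encoder always produces a canonical port assignment. *)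

theory Defs
  imports Complex_Main
begin

text \<open>A rooted tree on n nodes is represented with node set {0..<n}, root 0 and a parent
  function par (convention: par 0 = 0).  Every rooted tree on n nodes is isomorphic to
  such a representation.\<close>

definition is_rooted_tree :: "nat \<Rightarrow> (nat \<Rightarrow> nat) \<Rightarrow> bool" where
  "is_rooted_tree n par \<longleftrightarrow> 1 \<le> n \<and> par 0 = 0 \<and> (\<forall>v<n. par v < n)
     \<and> (\<forall>v<n. \<exists>k. (par ^^ k) v = 0)"

definition anc :: "(nat \<Rightarrow> nat) \<Rightarrow> nat \<Rightarrow> nat \<Rightarrow> bool" where
  "anc par u v \<longleftrightarrow> (\<exists>k. (par ^^ k) v = u)"

definition subtree_size :: "nat \<Rightarrow> (nat \<Rightarrow> nat) \<Rightarrow> nat \<Rightarrow> nat" where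
  "subtree_size n par u = card {v. v < n \<and> anc par u v}"

definition children :: "nat \<Rightarrow> (nat \<Rightarrow> nat) \<Rightarrow> nat \<Rightarrow> nat set" where
  "children n par u = {c. 0 < c \<and> c < n \<and> par c = u}"

text \<open>port c is the port number of the edge from par c to its child c.\<close>
definition valid_ports :: "nat \<Rightarrow> (nat \<Rightarrow> nat) \<Rightarrow> (nat \<Rightarrow> nat) \<Rightarrow> bool" where
  "valid_ports n par port \<longleftrightarrow>
     (\<forall>u<n. bij_betw port (children n par u) {1..card (children n par u)})"

definition canonical_ports :: "nat \<Rightarrow> (nat \<Rightarrow> nat) \<Rightarrow> (nat \<Rightarrow> nat) \<Rightarrow> bool" where
  "canonical_ports n par port \<longleftrightarrow> valid_ports n par port \<and>
     (\<forall>u<n. \<forall>c \<in> children n par u. \<forall>c' \<in> children n par u.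
        port c < port c' \<longrightarrow> subtree_size n par c' \<le> subtree_size n par c)"

text \<open>Correct routing answer from u to w (u \<noteq> w): 0 if the next node is the parent of u,
  otherwise the port of the child of u whose subtree contains w.\<close>
definition next_hop :: "nat \<Rightarrow> (nat \<Rightarrow> nat) \<Rightarrow> (nat \<Rightarrow> nat) \<Rightarrow> nat \<Rightarrow> nat \<Rightarrow> nat" where
  "next_hop n par port u w =
     (if anc par u w then port (THE c. c \<in> children n par u \<and> anc par c w) else 0)"

end

theory Submission
  imports Defs "HOL-Real_Asymp.Real_Asymp"
begin

text \<open>
  Nodes are placed on a line of length n powr p with p = 1 + 8 / e: along a heavy path, each node
  is followed by the regions of its light subtrees in port order, and then by its heavy child.
  The label of u holds its position, a rounded distance to the end of its region, and a short
  code for the lengths of the regions of its light children, so that the relative position of w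
  tells the port.  A light subtree of size s gets a region of length s powr p.  As s is at most
  half the size of the tree it branches off, s powr p leaves a relative saving of order 1 / e
  per light edge, which pays for rounding sizes to powers of 2 powr (1 / e).  Among the children
  whose size is within a factor 2 ^ b of the total, b = e * l, there are e * b size classes, so
  counting them costs e * b ^ 2 bits up to a constant; smaller children need no description at
  all, since the superlinear p saves a power of log n on them.  With K = log n and l = log K the
  redundancy 8 * K / e + O(e ^ 3 * l ^ 2) is balanced by e = K powr (1/4) / sqrt l.
\<close>

section \<open>Rooted trees: ancestors, children, subtree sizes, canonical ports\<close>

lemma sorted_enumeration:
  fixes key :: "'a \<Rightarrow> nat"
  assumes "finite A"
  shows "\<exists>f. bij_betw f A {1..card A} \<and> (\<forall>x\<in>A. \<forall>y\<in>A. f x < f y \<longrightarrow> key y \<le> key x)"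
  using assms
proof (induction "card A" arbitrary: A)
  case 0
  then show ?case by (simp add: bij_betw_def)
next
  case (Suc m)
  then have "A \<noteq> {}" by auto
  \<comment> \<open>An element of least key takes the last number \<open>Suc m\<close>; the rest is
    numbered by induction.\<close>
  then obtain a where a: "a \<in> A" "\<And>y. y \<in> A \<Longrightarrow> key a \<le> key y"
    using Suc.prems by (meson arg_min_if_finite(1) arg_min_least)
  have c: "card (A - {a}) = m" "card A = Suc m"
    using Suc a by (auto simp: card_Diff_singleton)
  obtain f where f: "bij_betw f (A - {a}) {1..m}"
    "\<forall>x\<in>A-{a}. \<forall>y\<in>A-{a}. f x < f y \<longrightarrow> key y \<le> key x"
    using Suc(1)[of "A - {a}"] Suc.prems c by auto
  let ?g = "f(a := Suc m)"
  have "bij_betw ?g (A - {a}) {1..m}"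
    by (rule bij_betw_cong[THEN iffD1, OF _ f(1)]) auto
  then have "bij_betw ?g ((A - {a}) \<union> {a}) ({1..m} \<union> {Suc m})"
    by (intro bij_betw_combine) auto
  moreover have "(A - {a}) \<union> {a} = A" "{1..m} \<union> {Suc m} = {1..Suc m}"
    using a by auto
  ultimately have b: "bij_betw ?g A {1..card A}" by (simp add: c)
  have "key y \<le> key x" if "x \<in> A" "y \<in> A" "?g x < ?g y" for x y
  proof (cases "y = a")
    case True
    then show ?thesis using a that by auto
  next
    case False
    then have "f y \<le> m" using f(1) that by (auto simp: bij_betw_def)
    then have "x \<noteq> a" using that False by auto
    then show ?thesis using f(2) that False by auto
  qed
  with b show ?case by blast
qed

locale rooted_tree =
  fixes n :: nat and par :: "nat \<Rightarrow> nat"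
  assumes tree: "is_rooted_tree n par"
begin

abbreviation subtree :: "nat \<Rightarrow> nat set" where
  "subtree v \<equiv> {w. w < n \<and> anc par v w}"

abbreviation sz :: "nat \<Rightarrow> nat" where
  "sz v \<equiv> subtree_size n par v"

abbreviation ch :: "nat \<Rightarrow> nat set" where
  "ch v \<equiv> children n par v"

lemma par0: "par 0 = 0" and par_less: "v < n \<Longrightarrow> par v < n"
  and reach_root: "v < n \<Longrightarrow> \<exists>k. (par ^^ k) v = 0"
  using tree by (auto simp: is_rooted_tree_def)

lemma funpow_par0: "(par ^^ k) 0 = 0"
  by (induction k) (auto simp: par0)

lemma funpow_par_less: "v < n \<Longrightarrow> (par ^^ k) v < n"
  by (induction k) (auto simp: par_less)

lemma anc_refl: "anc par v v"
  unfolding anc_def by (rule exI[of _ 0]) simp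

lemma anc_trans: "anc par u v \<Longrightarrow> anc par v w \<Longrightarrow> anc par u w"
  unfolding anc_def by (metis comp_apply funpow_add)

lemma anc_root: "v < n \<Longrightarrow> anc par 0 v"
  unfolding anc_def using reach_root by blast

text \<open>The root absorbs: from step \<open>j\<close> on the walk from \<open>v\<close> stays at
  0, yet after \<open>k * j >= j\<close> steps it is back at \<open>v\<close>. This is acyclicity in
  the form that tolerates the loop \<open>par 0 = 0\<close>.\<close>

lemma funpow_cycle_root:
  assumes "v < n" "(par ^^ k) v = v" "k > 0"
  shows "v = 0"
proof -
  obtain j where j: "(par ^^ j) v = 0" using reach_root assms(1) by blast
  have "((par ^^ k) ^^ j) v = v" for j
    by (induction j) (simp_all add: assms(2))
  then have "(par ^^ (k * j)) v = v" by (simp add: funpow_mult mult.commute)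
  moreover have "(par ^^ (k * j - j + j)) v = 0" by (simp only: funpow_add comp_apply j funpow_par0)
  moreover have "k * j - j + j = k * j" using assms(3) by simp
  ultimately show ?thesis by simp
qed

lemma anc_antisym:
  assumes "v < n" "anc par u v" "anc par v u"
  shows "u = v"
proof -
  obtain k j where kj: "(par ^^ k) v = u" "(par ^^ j) u = v"
    using assms by (auto simp: anc_def)
  then have "(par ^^ (j + k)) v = v" by (simp add: funpow_add)
  then have "j + k = 0 \<or> v = 0" using funpow_cycle_root[OF assms(1)] by blast
  then show ?thesis using kj funpow_par0 by auto
qed

lemma finite_ch: "finite (ch v)" by (auto simp: children_def)

lemma ch_less: "c \<in> ch v \<Longrightarrow> c < n" by (simp add: children_def)

lemma anc_ch: "c \<in> ch v \<Longrightarrow> anc par v c"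
  unfolding anc_def children_def by (rule exI[of _ 1]) simp

lemma not_anc_ch:
  assumes "c \<in> ch v" shows "\<not> anc par c v"
proof
  assume a: "anc par c v"
  have "v = c" using anc_antisym[OF ch_less[OF assms] anc_ch[OF assms] a] .
  then have "(par ^^ 1) c = c" using assms by (simp add: children_def)
  then have "c = 0" by (rule funpow_cycle_root[OF ch_less[OF assms]]) simp
  then show False using assms by (simp add: children_def)
qed

lemma ex_ch_anc:
  assumes "w \<in> subtree v" "w \<noteq> v"
  shows "\<exists>c\<in>ch v. w \<in> subtree c"
proof -
  \<comment> \<open>Minimality matters when \<open>v\<close> is the root: a longer walk could
    already sit at 0 one step earlier, and 0 is nobody's child.\<close>
  define k where "k = (LEAST k. (par ^^ k) w = v)"
  have "\<exists>k. (par ^^ k) w = v" using assms(1) by (simp add: anc_def)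
  then have k: "(par ^^ k) w = v" unfolding k_def by (rule LeastI_ex)
  obtain k' where k': "k = Suc k'" using k assms(2) by (cases k) auto
  let ?c = "(par ^^ k') w"
  have "par ?c = v" using k k' by simp
  moreover have "?c < n" using assms funpow_par_less by auto
  moreover have "?c \<noteq> v" using k' k_def not_less_Least[of k' "\<lambda>k. (par ^^ k) w = v"] by auto
  ultimately have "?c \<in> ch v" using par0 by (auto simp: children_def intro!: Nat.gr0I)
  moreover have "anc par ?c w" by (auto simp: anc_def)
  ultimately show ?thesis using assms by blast
qed

text \<open>If the walk from \<open>w\<close> met \<open>c\<close> strictly before
  \<open>c'\<close>, it would pass through \<open>par c = v\<close> on the way, and
  \<open>c'\<close> would be an ancestor of its own parent.\<close>

lemma ch_unique_aux:
  assumes "c \<in> ch v" "c' \<in> ch v" "(par ^^ i) w = c" "(par ^^ j) w = c'" "i \<le> j"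
  shows "c = c'"
proof (rule ccontr)
  assume ne: "c \<noteq> c'"
  then have "i < j" using assms(3-5) by (cases "i = j") auto
  then obtain d where d: "j = Suc (d + i)" using less_iff_Suc_add by (metis add.commute)
  have "c' = (par ^^ d) (par c)"
    using assms(3,4) by (simp add: d funpow_add funpow_swap1)
  moreover have "par c = v" using assms(1) by (simp add: children_def)
  ultimately have "anc par c' v" by (auto simp: anc_def)
  then show False using not_anc_ch[OF assms(2)] by simp
qed

lemma ch_unique:
  assumes "c \<in> ch v" "c' \<in> ch v" "anc par c w" "anc par c' w"
  shows "c = c'"
proof -
  obtain i j where ij: "(par ^^ i) w = c" "(par ^^ j) w = c'"
    using assms(3,4) by (auto simp: anc_def)
  show ?thesis
    using ch_unique_aux[OF assms(1,2) ij] ch_unique_aux[OF assms(2,1) ij(2,1)] by (cases "i \<le> j") auto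
qed

lemma subtree_decomp:
  assumes "v < n"
  shows "subtree v = insert v (\<Union>c\<in>ch v. subtree c)"
proof
  show "subtree v \<subseteq> insert v (\<Union>c\<in>ch v. subtree c)" using ex_ch_anc by blast
  show "insert v (\<Union>c\<in>ch v. subtree c) \<subseteq> subtree v"
    using assms anc_refl anc_trans[OF anc_ch] by auto
qed

lemma subtree_size_eq:
  assumes "v < n"
  shows "sz v = 1 + (\<Sum>c\<in>ch v. sz c)"
proof -
  have "card (\<Union>c\<in>ch v. subtree c) = (\<Sum>c\<in>ch v. sz c)"
    unfolding subtree_size_def
    by (rule card_UN_disjoint) (use ch_unique finite_ch in auto)
  moreover have "v \<notin> (\<Union>c\<in>ch v. subtree c)" using not_anc_ch by auto
  moreover have "sz v = card (insert v (\<Union>c\<in>ch v. subtree c))"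
    unfolding subtree_size_def by (subst subtree_decomp[OF assms]) simp
  ultimately show ?thesis using finite_ch by simp
qed

lemma subtree_size_pos: "v < n \<Longrightarrow> 1 \<le> sz v"
  using subtree_size_eq by simp

lemma subtree_size_root: "sz 0 = n"
proof -
  have "subtree 0 = {..<n}" using anc_root by auto
  then show ?thesis by (simp add: subtree_size_def)
qed

lemma next_hop_ch:
  assumes "c \<in> ch u" "w \<in> subtree c"
  shows "next_hop n par port u w = port c"
proof -
  have "anc par u w" using assms anc_ch anc_trans by blast
  moreover have "(THE c. c \<in> ch u \<and> anc par c w) = c"
    using assms ch_unique by blast
  ultimately show ?thesis by (simp add: next_hop_def)
qed

lemma next_hop_not_anc: "\<not> anc par u w \<Longrightarrow> next_hop n par port u w = 0"
  by (simp add: next_hop_def)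

lemma ex_canonical_ports: "\<exists>port. canonical_ports n par port"
proof -
  have "\<exists>f. bij_betw f (ch u) {1..card (ch u)} \<and>
      (\<forall>x\<in>ch u. \<forall>y\<in>ch u. f x < f y \<longrightarrow> sz y \<le> sz x)" for u
    using sorted_enumeration[OF finite_ch] by blast
  then obtain f where f: "\<And>u. bij_betw (f u) (ch u) {1..card (ch u)}"
    "\<And>u x y. x \<in> ch u \<Longrightarrow> y \<in> ch u \<Longrightarrow> f u x < f u y \<Longrightarrow> sz y \<le> sz x"
    by metis
  let ?p = "\<lambda>c. f (par c) c"
  have "?p c = f u c" if "c \<in> ch u" for u c using that by (simp add: children_def)
  then have "bij_betw ?p (ch u) {1..card (ch u)}" for u
    using f(1)[of u] by (simp cong: bij_betw_cong)
  moreover have "sz y \<le> sz x" if "x \<in> ch u" "y \<in> ch u" "?p x < ?p y" for u x y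
    using f(2)[of x u y] that by (simp add: children_def)
  ultimately show ?thesis
    unfolding canonical_ports_def valid_ports_def by blast
qed

end

section \<open>Decoding, and placing a tree on the line\<close>

text \<open>
  A label is (num u, D, r), and y below is num w - num u.  All descendants of u satisfy
  0 < y < D.  The light child with port i + 1 owns the offsets in (P (i - 1), P i] where
  P i = r 1 + ... + r i, and the heavy child, which has port 1, owns those beyond P J.
\<close>
definition decode :: "nat \<Rightarrow> nat \<times> (nat \<Rightarrow> nat) \<Rightarrow> int \<Rightarrow> nat" where
  "decode J a y =
    (if y < 0 \<or> int (fst a) \<le> y then 0
     else if int (\<Sum>k=1..J. snd a k) < y then 1
     else Suc (LEAST i. y \<le> int (\<Sum>k=1..i. snd a k)))"

lemma decode_nat:
  "decode J (D, r) (int y) =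
    (if D \<le> y then 0 else if (\<Sum>k=1..J. r k) < y then 1 else Suc (LEAST i. y \<le> (\<Sum>k=1..i. r k)))"
  unfolding decode_def of_nat_le_iff of_nat_less_iff fst_conv snd_conv by simp

text \<open>
  need N s is the space for a node with s descendants (itself included) on a heavy path whose top
  has at most N descendants; F s is the space of a whole region handed to a light subtree.  The
  difference G N lets the distance to the end of a region be rounded to an extent in A, so
  that only few values of it occur in labels.
\<close>
locale layout = rooted_tree +
  fixes J :: nat and A :: "nat set" and R :: "(nat \<Rightarrow> nat) set"
    and F :: "nat \<Rightarrow> nat" and need :: "nat \<Rightarrow> nat \<Rightarrow> nat" and G :: "nat \<Rightarrow> nat"
  assumes n_le: "n \<le> J"
    and light: "\<And>N h d s. \<lbrakk>N \<le> J; \<And>i. i \<in> {1..d} \<Longrightarrow> 1 \<le> s i \<and> s i \<le> h;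
          \<And>i j. 1 \<le> i \<Longrightarrow> i \<le> j \<Longrightarrow> j \<le> d \<Longrightarrow> s j \<le> s i; 1 + h + (\<Sum>i=1..d. s i) \<le> N\<rbrakk>
        \<Longrightarrow> \<exists>r\<in>R. (\<forall>i\<in>{1..d}. F (s i) \<le> r i) \<and>
              1 + (\<Sum>i=1..J. r i) + (if h = 0 then 0 else need N h) \<le> need N (1 + h + (\<Sum>i=1..d. s i))"
    and region: "\<And>s. 1 \<le> s \<Longrightarrow> s \<le> J \<Longrightarrow> need s s + G s \<le> F s"
    and extent: "\<And>s N. 1 \<le> s \<Longrightarrow> s \<le> N \<Longrightarrow> N \<le> J \<Longrightarrow> \<exists>D\<in>A. need N s \<le> D \<and> D \<le> need N s + G N"
begin

text \<open>Induction on the subtree size. The third clause speaks of arbitrary positions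
  \<open>y\<close>, so that it covers nodes in any other part of the tree: whatever lies outside the
  interval of a subtree gets the answer "parent". This makes intervals of siblings independent.
  \<open>N\<close> is general because heavy and light children continue with different values of
  it.\<close>

lemma place:
  assumes port: "canonical_ports n par port"
    and "v < n" "sz v \<le> N" "N \<le> J"
  shows "\<exists>num aux. (\<forall>u\<in>subtree v. num u < need N (sz v) \<and> aux u \<in> A \<times> R)
    \<and> (\<forall>u\<in>subtree v. \<forall>w\<in>subtree v. u \<noteq> w \<longrightarrow>
          decode J (aux u) (int (num w) - int (num u)) = next_hop n par port u w)
    \<and> (\<forall>u\<in>subtree v. \<forall>y. y < 0 \<or> int (need N (sz v) + G N) \<le> y \<longrightarrow>
          decode J (aux u) (y - int (num u)) = 0)"
  using assms(2-4)
proof (induction "sz v" arbitrary: v N rule: less_induct)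
  case less
  let ?d = "card (ch v) - 1"
  have bij: "bij_betw port (ch v) {1..card (ch v)}"
    using port less.prems by (auto simp: canonical_ports_def valid_ports_def)
  have mono: "sz y \<le> sz x" if "x \<in> ch v" "y \<in> ch v" "port x < port y" for x y
    using port less.prems that by (auto simp: canonical_ports_def)
  define cc where "cc = the_inv_into (ch v) port"
  have cc: "cc j \<in> ch v \<and> port (cc j) = j" if "j \<in> {1..card (ch v)}" for j
    using bij that unfolding cc_def
    by (metis bij_betw_def f_the_inv_into_f_bij_betw order_refl the_inv_into_into)
  have cc_port: "cc (port c) = c" if "c \<in> ch v" for c
    unfolding cc_def using bij that by (simp add: bij_betw_def the_inv_into_f_f)
  have port_range: "port c \<in> {1..card (ch v)}" if "c \<in> ch v" for c
    using bij that by (auto simp: bij_betw_def)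
  \<comment> \<open>Light children are indexed by port minus one, as in assumption
    \<open>light\<close>; \<open>h = 0\<close> encodes a leaf.\<close>
  define s where "s i = sz (cc (Suc i))" for i
  define h where "h = (if ch v = {} then 0 else sz (cc 1))"
  have s_h: "1 \<le> s i \<and> s i \<le> h" if "i \<in> {1..?d}" for i
  proof -
    have i: "cc (Suc i) \<in> ch v \<and> port (cc (Suc i)) = Suc i" "cc 1 \<in> ch v \<and> port (cc 1) = 1"
      using cc[of "Suc i"] cc[of 1] that by auto
    moreover have "ch v \<noteq> {}" using i by auto
    ultimately show ?thesis
      using subtree_size_pos[OF ch_less[of "cc (Suc i)" v]] mono[of "cc 1" "cc (Suc i)"] that
      by (auto simp: s_def h_def)
  qed
  have s_mono: "s j \<le> s i" if "1 \<le> i" "i \<le> j" "j \<le> ?d" for i j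
    using mono[of "cc (Suc i)" "cc (Suc j)"] cc[of "Suc i"] cc[of "Suc j"] that
    by (cases "i = j") (auto simp: s_def)
  have "(\<Sum>c\<in>ch v. sz c) = (\<Sum>j=1..card (ch v). sz (cc j))"
    using sum.reindex_bij_betw[OF bij, of "\<lambda>j. sz (cc j)"] by (simp add: cc_port cong: sum.cong)
  also have "\<dots> = h + (\<Sum>i=1..?d. s i)"
  proof (cases "ch v = {}")
    case False
    then have "card (ch v) > 0" using finite_ch by (simp add: card_gt_0_iff)
    then have c: "card (ch v) = Suc ?d" by simp
    have "(\<Sum>j=1..Suc ?d. sz (cc j)) = sz (cc 1) + (\<Sum>j=Suc 1..Suc ?d. sz (cc j))"
      by (rule sum.atLeast_Suc_atMost) simp
    also have "(\<Sum>j=Suc 1..Suc ?d. sz (cc j)) = (\<Sum>i=1..?d. s i)"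
      unfolding s_def by (rule sum.shift_bounds_cl_Suc_ivl)
    finally show ?thesis using False c by (simp add: h_def)
  qed (simp add: h_def)
  finally have size: "sz v = 1 + h + (\<Sum>i=1..?d. s i)"
    using subtree_size_eq[OF less.prems(1)] by simp
  obtain r where r: "r \<in> R" "\<And>i. i \<in> {1..?d} \<Longrightarrow> F (s i) \<le> r i"
    "1 + (\<Sum>i=1..J. r i) + (if h = 0 then 0 else need N h) \<le> need N (sz v)"
    using light[of N ?d s h, OF less.prems(3) s_h s_mono] less.prems(2) unfolding size by blast
  \<comment> \<open>The bounds on \<open>D\<close> serve two clauses: \<open>D\<close> exceeds every
    offset inside the subtree, and it does not reach past the end of the interval.\<close>
  obtain D where D: "D \<in> A" "need N (sz v) \<le> D" "D \<le> need N (sz v) + G N"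
    using extent[OF subtree_size_pos[OF less.prems(1)] less.prems(2,3)] by blast
  define P where "P i = (\<Sum>k=1..i. r k)" for i
  have P_mono: "P i \<le> P j" if "i \<le> j" for i j
    unfolding P_def using that by (intro sum_mono2) auto
  have P_Suc: "P (Suc i) = P i + r (Suc i)" for i by (simp add: P_def)
  have card_le: "card (ch v) \<le> J"
  proof -
    have "card (ch v) \<le> card {..<n}" by (rule card_mono) (auto simp: children_def)
    then show ?thesis using n_le by simp
  qed
  \<comment> \<open>Position 0 is \<open>v\<close> itself, whence \<open>1 +\<close>. The heavy
    child comes after all \<open>J\<close> slots, even those without a child, because the decoder
    does not know the degree.\<close>
  define off where "off c = (if port c = 1 then 1 + P J else 1 + P (port c - 2))" for c
  \<comment> \<open>a heavy child stays on the heavy path of v and keeps its N; a light child starts a new one\<close>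
  define bud where "bud c = (if port c = 1 then N else sz c)" for c
  define len where "len c = need (bud c) (sz c) + G (bud c)" for c
  have sz_less: "sz c < sz v" if "c \<in> ch v" for c
  proof -
    have "sz c \<le> (\<Sum>c\<in>ch v. sz c)" by (rule member_le_sum) (use that finite_ch in auto)
    then show ?thesis using subtree_size_eq[OF less.prems(1)] by simp
  qed
  define placed where "placed c num aux \<longleftrightarrow>
    (\<forall>u\<in>subtree c. num u < need (bud c) (sz c) \<and> aux u \<in> A \<times> R)
    \<and> (\<forall>u\<in>subtree c. \<forall>w\<in>subtree c. u \<noteq> w \<longrightarrow>
          decode J (aux u) (int (num w) - int (num u)) = next_hop n par port u w)
    \<and> (\<forall>u\<in>subtree c. \<forall>y. y < 0 \<or> int (len c) \<le> y \<longrightarrow>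
          decode J (aux u) (y - int (num u)) = 0)" for c num aux
  have "\<exists>num aux. placed c num aux" if "c \<in> ch v" for c
    unfolding len_def placed_def
    by (rule less.hyps[OF sz_less[OF that] ch_less[OF that]])
       (use sz_less[OF that] less.prems in \<open>auto simp: bud_def\<close>)
  then obtain nm ax where p: "\<And>c. c \<in> ch v \<Longrightarrow> placed c (nm c) (ax c)"
    by metis
  have nm: "nm c u < need (bud c) (sz c)" and ax: "ax c u \<in> A \<times> R"
    if "c \<in> ch v" "u \<in> subtree c" for c u
    using p[OF that(1)] that(2) unfolding placed_def by blast+
  have inside: "decode J (ax c u) (int (nm c w) - int (nm c u)) = next_hop n par port u w"
    if "c \<in> ch v" "u \<in> subtree c" "w \<in> subtree c" "u \<noteq> w" for c u w
    using p[OF that(1)] that(2-) unfolding placed_def by blast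
  have outside: "decode J (ax c u) (y - int (nm c u)) = 0"
    if "c \<in> ch v" "u \<in> subtree c" "y < 0 \<or> int (len c) \<le> y" for c u y
    using p[OF that(1)] that(2-) unfolding placed_def by blast
  define top where "top w = (THE c. c \<in> ch v \<and> w \<in> subtree c)" for w
  have top: "top w = c" if "c \<in> ch v" "w \<in> subtree c" for c w
    unfolding top_def using that ch_unique by blast
  define num where "num w = (if w = v then 0 else off (top w) + nm (top w) w)" for w
  define aux where "aux w = (if w = v then (D, r) else ax (top w) w)" for w
  have not_v: "v \<notin> subtree c" if "c \<in> ch v" for c using not_anc_ch[OF that] by simp
  have num_ch: "num w = off c + nm c w" and aux_ch: "aux w = ax c w"
    if "c \<in> ch v" "w \<in> subtree c" for c w
    using that not_v[of c] top[of c w] by (auto simp: num_def aux_def)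
  have num_v: "num v = 0" "aux v = (D, r)" by (simp_all add: num_def aux_def)
  have light_len: "off c + len c \<le> 1 + P (port c - 1)" "len c \<le> r (port c - 1)"
    "port c - 1 \<in> {1..?d}" if "c \<in> ch v" "port c \<noteq> 1" for c
  proof -
    show j: "port c - 1 \<in> {1..?d}" using port_range[OF that(1)] that(2) by auto
    then have "s (port c - 1) = sz c" using cc_port[OF that(1)] by (auto simp: s_def)
    then have "F (sz c) \<le> r (port c - 1)" using r(2)[OF j] by simp
    moreover have "need (sz c) (sz c) + G (sz c) \<le> F (sz c)"
      using region subtree_size_pos[OF ch_less[OF that(1)]] sz_less[OF that(1)] less.prems by simp
    ultimately show l: "len c \<le> r (port c - 1)" using that(2) by (simp add: len_def bud_def)
    have "port c - 1 = Suc (port c - 2)" using j by auto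
    then have "P (port c - 1) = P (port c - 2) + r (port c - 1)" using P_Suc by metis
    then show "off c + len c \<le> 1 + P (port c - 1)" using l that(2) by (simp add: off_def)
  qed
  \<comment> \<open>The heavy child keeps \<open>N\<close>, so the gap \<open>G N\<close> at its end
    is the gap of \<open>v\<close>: it is paid for once per heavy path, not once per node.\<close>
  have heavy_len: "off c + len c \<le> need N (sz v) + G N" "off c + need N (sz c) \<le> need N (sz v)"
    if "c \<in> ch v" "port c = 1" for c
  proof -
    have "cc 1 = c" using cc_port[OF that(1)] that(2) by simp
    moreover have "ch v \<noteq> {}" using that(1) by auto
    ultimately have "h = sz c" by (simp add: h_def)
    moreover have "sz c \<ge> 1" using subtree_size_pos[OF ch_less[OF that(1)]] .
    ultimately show "off c + need N (sz c) \<le> need N (sz v)"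
      using r(3) that(2) by (simp add: off_def P_def)
    then show "off c + len c \<le> need N (sz v) + G N" using that(2) by (simp add: len_def bud_def)
  qed
  have total: "1 + P J \<le> need N (sz v)" using r(3) by (simp add: P_def)
  have ch_len: "off c + len c \<le> need N (sz v) + G N" if "c \<in> ch v" for c
  proof (cases "port c = 1")
    case False
    have "P (port c - 1) \<le> P J"
      by (rule P_mono) (use light_len(3)[OF that False] card_le in auto)
    then show ?thesis using light_len(1)[OF that False] total by simp
  qed (use heavy_len that in simp)
  have num_less: "num u < need N (sz v)" if "c \<in> ch v" "u \<in> subtree c" for c u
  proof (cases "port c = 1")
    case True
    then show ?thesis using heavy_len(2)[OF that(1) True] nm[OF that] num_ch[OF that]
      by (simp add: bud_def)
  next
    case False
    have "P (port c - 1) \<le> P J"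
      by (rule P_mono) (use light_len(3)[OF that(1) False] card_le in auto)
    then show ?thesis
      using light_len(1)[OF that(1) False] total nm[OF that] num_ch[OF that] by (simp add: len_def)
  qed
  have off_pos: "off c \<ge> 1" for c by (simp add: off_def)
  \<comment> \<open>Intervals follow the port order, except that the heavy child with port 1 comes
    last.\<close>
  have disj: "off c + len c \<le> off c' \<or> off c' + len c' \<le> off c"
    if "c \<in> ch v" "c' \<in> ch v" "port c < port c'" for c c'
  proof (cases "port c = 1")
    case True
    then have 1: "port c' \<noteq> 1" using that by auto
    have "P (port c' - 1) \<le> P J"
      by (rule P_mono) (use light_len(3)[OF that(2) 1] card_le in auto)
    then show ?thesis using light_len(1)[OF that(2) 1] True by (simp add: off_def)
  next
    case False
    have "P (port c - 1) \<le> P (port c' - 2)" by (rule P_mono) (use that in auto)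
    moreover have "port c' \<noteq> 1" using that port_range[OF that(1)] by auto
    ultimately show ?thesis using light_len(1)[OF that(1) False] by (simp add: off_def)
  qed
  have disj': "off c + len c \<le> off c' \<or> off c' + len c' \<le> off c"
    if "c \<in> ch v" "c' \<in> ch v" "c \<noteq> c'" for c c'
    using disj[of c c'] disj[of c' c] that cc_port by (metis linorder_neqE_nat)
  have cases: "w = v \<or> (\<exists>c\<in>ch v. w \<in> subtree c)" if "w \<in> subtree v" for w
    using that ex_ch_anc by blast
  have from_v: "decode J (aux v) (int (num w) - int (num v)) = port c"
    if "c \<in> ch v" "w \<in> subtree c" for c w
  proof -
    let ?y = "off c + nm c w"
    have y: "?y < D" "1 \<le> ?y" using num_less[OF that] num_ch[OF that] D(2) off_pos[of c] by auto
    have "decode J (D, r) (int ?y) = port c"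
    proof (cases "port c = 1")
      case True
      then have "P J < ?y" by (simp add: off_def)
      then show ?thesis using y True unfolding decode_nat P_def[symmetric] by simp
    next
      case False
      note l = light_len[OF that(1) False]
      have lt: "?y \<le> P (port c - 1)" using l(1) nm[OF that] by (simp add: len_def)
      have "P (port c - 1) \<le> P J" by (rule P_mono) (use l(3) card_le in auto)
      then have le: "\<not> P J < ?y" using lt by simp
      \<comment> \<open>The offsets of \<open>c\<close> start at \<open>1 + P (port c - 2)\<close>,
        hence no smaller index reaches them.\<close>
      have "(LEAST i. ?y \<le> P i) = port c - 1"
      proof (rule Least_equality)
        fix i assume i: "?y \<le> P i"
        show "port c - 1 \<le> i"
        proof (rule ccontr)
          assume "\<not> port c - 1 \<le> i"
          then have "P i \<le> P (port c - 2)" by (intro P_mono) auto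
          then show False using i False by (simp add: off_def)
        qed
      qed (rule lt)
      moreover have "Suc (port c - 1) = port c" using l(3) by auto
      ultimately show ?thesis using y le unfolding decode_nat P_def[symmetric] by simp
    qed
    then show ?thesis using num_v num_ch[OF that] by simp
  qed
  have out_ch: "decode J (aux u) (y - int (num u)) = 0"
    if "c \<in> ch v" "u \<in> subtree c" "y < int (off c) \<or> int (off c + len c) \<le> y" for c u y
    using outside[OF that(1,2), of "y - int (off c)"] that num_ch[OF that(1,2)] aux_ch[OF that(1,2)]
    by (auto simp: algebra_simps)
  have A: "num u < need N (sz v) \<and> aux u \<in> A \<times> R" if "u \<in> subtree v" for u
    using cases[OF that] num_less ax aux_ch num_v total D(1) r(1) by auto
  have B: "decode J (aux u) (int (num w) - int (num u)) = next_hop n par port u w"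
    if uw: "u \<in> subtree v" "w \<in> subtree v" "u \<noteq> w" for u w
  proof (cases "u = v")
    case True
    then obtain c where c: "c \<in> ch v" "w \<in> subtree c" using cases[OF uw(2)] uw(3) by auto
    then show ?thesis using from_v[OF c] next_hop_ch[OF c] True by simp
  next
    case False
    then obtain c where c: "c \<in> ch v" "u \<in> subtree c" using cases[OF uw(1)] by auto
    show ?thesis
    proof (cases "w \<in> subtree c")
      case True
      then show ?thesis
        using inside[OF c True uw(3)] num_ch[OF c] num_ch[OF c(1) True] aux_ch[OF c] by simp
    next
      case False
      have "\<not> anc par u w" using False c uw anc_trans by blast
      then have nh: "next_hop n par port u w = 0" by (rule next_hop_not_anc)
      \<comment> \<open>Wherever \<open>w\<close> lies outside the subtree of \<open>c\<close>, its
        position misses the interval of \<open>c\<close>.\<close>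
      have "int (num w) < int (off c) \<or> int (off c + len c) \<le> int (num w)"
      proof (cases "w = v")
        case True
        then show ?thesis using num_v off_pos[of c] by simp
      next
        case w: False
        then obtain c' where c': "c' \<in> ch v" "w \<in> subtree c'" using cases[OF uw(2)] by auto
        then have "c \<noteq> c'" using False by auto
        then have "off c + len c \<le> off c' \<or> off c' + len c' \<le> off c"
          using disj' c c' by blast
        moreover have "nm c' w < len c'" using nm[OF c'] by (simp add: len_def)
        ultimately show ?thesis using num_ch[OF c'] by auto
      qed
      then show ?thesis using out_ch[OF c] nh by simp
    qed
  qed
  have C: "decode J (aux u) (y - int (num u)) = 0"
    if uy: "u \<in> subtree v" "y < 0 \<or> int (need N (sz v) + G N) \<le> y" for u y
  proof (cases "u = v")
    case True
    then show ?thesis using uy num_v D(3) by (auto simp: decode_def)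
  next
    case False
    then obtain c where c: "c \<in> ch v" "u \<in> subtree c" using cases[OF uy(1)] by auto
    then show ?thesis using out_ch[OF c, of y] ch_len[OF c(1)] off_pos[of c] uy by auto
  qed
  show ?case
    by (rule exI[of _ num], rule exI[of _ aux], intro conjI[OF _ conjI] ballI allI impI;
        (rule A B C; assumption))
qed

lemma ex_labelling:
  "\<exists>port lab. canonical_ports n par port \<and> (\<forall>u<n. lab u \<in> {..<need n n} \<times> (A \<times> R))
    \<and> (\<forall>u<n. \<forall>w<n. u \<noteq> w \<longrightarrow>
          decode J (snd (lab u)) (int (fst (lab w)) - int (fst (lab u))) = next_hop n par port u w)"
proof -
  obtain port where port: "canonical_ports n par port" using ex_canonical_ports by blast
  have n: "0 < n" using tree by (simp add: is_rooted_tree_def)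
  have "subtree 0 = {..<n}" using anc_root by auto
  then obtain num aux where
    "\<forall>u<n. num u < need n n \<and> aux u \<in> A \<times> R"
    "\<forall>u<n. \<forall>w<n. u \<noteq> w \<longrightarrow>
          decode J (aux u) (int (num w) - int (num u)) = next_hop n par port u w"
    using place[OF port n, of n] subtree_size_root n_le by (simp add: Ball_def) blast
  then show ?thesis using port by (intro exI[of _ port] exI[of _ "\<lambda>u. (num u, aux u)"]) auto
qed

end

section \<open>Elementary estimates\<close>

lemma two_powr_ge: "1 + x / 2 \<le> 2 powr x" if "0 \<le> x" for x :: real
proof -
  \<comment> \<open>The bound \<open>ln x <= x - 1\<close> at \<open>x = 1 / 2\<close> gives
    \<open>ln 2 >= 1 / 2\<close>.\<close>
  have "ln (1 / 2 :: real) \<le> 1 / 2 - 1" by (rule ln_le_minus_one) simp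
  then have "1 / 2 \<le> ln (2 :: real)" by (simp add: ln_div)
  then have "x / 2 \<le> x * ln 2" using that by (simp add: mult_left_mono[of "1 / 2" "ln 2" x, simplified])
  also have "1 + x * ln 2 \<le> exp (x * ln 2)" by (rule exp_ge_add_one_self)
  finally show ?thesis by (simp add: powr_def)
qed

lemma two_powr_nat: "2 powr real k = real (2 ^ k)"
  by (simp add: powr_realpow)

text \<open>Each dyadic block from \<open>2 ^ K + 1\<close> to \<open>2 ^ Suc K\<close> has
  \<open>2 ^ K\<close> terms of size at most \<open>1 / 2 ^ K\<close>, and so adds at most
  1.\<close>

lemma harmonic_le: "(\<Sum>i=1..2 ^ K. 1 / real i) \<le> real K + 1"
proof (induction K)
  case (Suc K)
  have "(\<Sum>i=1..2 ^ Suc K. 1 / real i) =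
      (\<Sum>i=1..2 ^ K. 1 / real i) + (\<Sum>i=2 ^ K + 1..2 ^ K + 2 ^ K. 1 / real i)"
    using sum.ub_add_nat[of 1 "2 ^ K" "\<lambda>i. 1 / real i" "2 ^ K"] by (simp add: mult_2)
  also have "(\<Sum>i=2 ^ K + 1..2 ^ K + 2 ^ K. 1 / real i) \<le>
      (\<Sum>i=2 ^ K + 1..2 ^ K + (2 :: nat) ^ K. 1 / 2 ^ K)"
  proof (rule sum_mono)
    fix i :: nat assume "i \<in> {2 ^ K + 1..2 ^ K + 2 ^ K}"
    then have "2 ^ K \<le> i" by simp
    then have "(2 :: real) ^ K \<le> real i" by (metis of_nat_le_iff of_nat_numeral of_nat_power)
    then show "1 / real i \<le> 1 / 2 ^ K" by (simp add: frac_le)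
  qed
  also have "\<dots> = 1" by simp
  finally show ?case using Suc by simp
qed simp

text \<open>In a nonincreasing sequence the terms above a threshold form an initial segment, so
  their number determines which they are. Hence counts alone can describe the sizes of children in
  port order.\<close>

lemma antimono_upper_set:
  fixes s :: "nat \<Rightarrow> nat" and x :: real
  assumes "\<And>i j. 1 \<le> i \<Longrightarrow> i \<le> j \<Longrightarrow> j \<le> d \<Longrightarrow> s j \<le> s i" "1 \<le> i"
  shows "i \<le> card {k \<in> {1..d}. x < real (s k)} \<longleftrightarrow> i \<le> d \<and> x < real (s i)" (is "i \<le> card ?X \<longleftrightarrow> _")
proof
  have down: "j \<in> ?X" if "k \<in> ?X" "1 \<le> j" "j \<le> k" for j k
    using assms(1)[of j k] that by force
  assume i: "i \<le> card ?X"
  have "i \<in> ?X"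
  proof (rule ccontr)
    assume "i \<notin> ?X"
    then have "j < i" if "j \<in> ?X" for j
      using down[OF that assms(2)] by (cases "j < i") auto
    then have "?X \<subseteq> {1..<i}" by (auto simp del: One_nat_def)
    then have "card ?X \<le> card {1..<i}" by (intro card_mono) auto
    then show False using i assms(2) by simp
  qed
  then show "i \<le> d \<and> x < real (s i)" by simp
next
  assume "i \<le> d \<and> x < real (s i)"
  then have "{1..i} \<subseteq> ?X" using assms(1)[of _ i] by force
  then have "card {1..i} \<le> card ?X" by (intro card_mono) auto
  then show "i \<le> card ?X" by simp
qed

section \<open>Concrete sizes, gaps and extents\<close>

locale parameters =
  fixes K e l :: nat
  assumes e16: "16 \<le> e" and e_le: "e \<le> 2 ^ l" and K_le: "K + 1 \<le> 2 ^ l"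
begin

definition p :: real where "p = 1 + 8 / e"
definition size_bound :: "nat \<Rightarrow> nat" where "size_bound s = nat \<lfloor>real s powr p\<rfloor>"
text \<open>Apart from rounding this is linear in \<open>s\<close> with a density fixed by the top
  of the heavy path. The missing share \<open>2 / e\<close> of \<open>N powr p\<close> is left for
  the gap. The \<open>max 1\<close> gives a one-node path its position.\<close>

definition need :: "nat \<Rightarrow> nat \<Rightarrow> nat" where
  "need N s = max 1 (nat \<lfloor>(1 - 2 / e) * s * real N powr (8 / e)\<rfloor>)"
text \<open>It depends on \<open>N\<close> only through \<open>t\<close>, the floor of
  \<open>log 2 N\<close>, so that all \<open>N\<close> in a dyadic range share one rounding
  grid.\<close>

definition gap :: "nat \<Rightarrow> nat" where
  "gap t = nat \<lfloor>2 / e * 2 powr (p * t)\<rfloor>"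
definition slack :: "nat \<Rightarrow> nat" where
  "slack N = gap (nat \<lfloor>log 2 N\<rfloor>)"
text \<open>Grid points of step \<open>Suc (gap t)\<close>: each window of \<open>gap t + 1\<close>
  consecutive numbers contains exactly one multiple of the step, and the step is positive even if
  the gap is 0.\<close>

definition extents :: "nat set" where
  "extents = (\<lambda>(t, m). m * Suc (gap t)) ` ({..K} \<times> {..2 * e})"
text \<open>The number of classes of ratio \<open>2 powr (1 / e)\<close> that span a factor
  \<open>2 ^ (e * l)\<close>.\<close>

definition Q :: nat where "Q = e * (e * l)"

text \<open>
  The list c counts children by geometric size class: c ! r is the number of light children larger
  than 2 powr ((\<tau> - r - 1) / e), where 2 powr (\<tau> / e) is about the total S of their sizes.
  Children in the top Q classes are large and get the space of their class.  The i-th of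
  the remaining ones has size at most S / i and at most S / 2 ^ (e * l), which fixes its region
  from i alone; the waste of these harmonic regions is logarithmic and is absorbed because
  x powr p grows superlinearly.
\<close>
definition region :: "nat \<Rightarrow> nat list \<Rightarrow> nat \<Rightarrow> nat" where
  "region \<tau> c i =
    nat \<lfloor>(if \<exists>r<Q. i \<le> c ! r
      then 2 powr ((real \<tau> - real (LEAST r. r < Q \<and> i \<le> c ! r)) / e)
      else 2 powr (\<tau> / e) / max (2 ^ (e * l)) (real i)) powr p\<rfloor>"
text \<open>The zero function serves nodes without light children, for which there is no total to
  take a logarithm of.\<close>

definition regions :: "(nat \<Rightarrow> nat) set" where
  "regions = insert (\<lambda>_. 0) ((\<lambda>(\<tau>, c). region \<tau> c) `
     ({..e * K} \<times> {c. set c \<subseteq> {..2 ^ (e * l)} \<and> length c = Q}))"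

lemma e_pos: "0 < e" "0 < real e" using e16 by auto

lemma p_bounds: "1 \<le> p" "p \<le> 3 / 2" "1 < p"
  using e16 by (auto simp: p_def field_simps)

lemma powr_p: "0 \<le> x \<Longrightarrow> x powr p = x * x powr (8 / e)"
  by (cases "x = 0") (auto simp: p_def powr_add)

text \<open>Since \<open>2 powr (8 / e) >= 1 + 4 / e\<close>, the superlinear exponent outweighs the
  share \<open>2 / e\<close> given up for gaps. With density at least 1, every node pays for its own
  position.\<close>

lemma sigma_powr:
  assumes "2 \<le> N"
  shows "1 \<le> (1 - 2 / e) * real N powr (8 / e)"
proof -
  have "1 \<le> (1 - 2 / e) * (1 + (8 / e) / 2)"
    using e16 by (simp add: field_simps)
  also have "\<dots> \<le> (1 - 2 / e) * 2 powr (8 / e)"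
    using e16 by (intro mult_left_mono two_powr_ge) auto
  also have "\<dots> \<le> (1 - 2 / e) * real N powr (8 / e)"
    using e16 assms by (intro mult_left_mono powr_mono2) auto
  finally show ?thesis .
qed

lemma floor_log_bounds:
  assumes "1 \<le> N"
  shows "2 powr nat \<lfloor>log 2 N\<rfloor> \<le> real N" "real N < 2 powr (nat \<lfloor>log 2 N\<rfloor> + 1)"
proof -
  have "0 \<le> log 2 N" using assms by simp
  then have 1: "real (nat \<lfloor>log 2 N\<rfloor>) \<le> log 2 N" "log 2 N < nat \<lfloor>log 2 N\<rfloor> + 1"
    by linarith+
  have N: "2 powr (log 2 N) = N" using assms by simp
  show "2 powr nat \<lfloor>log 2 N\<rfloor> \<le> real N"
    using powr_mono[OF 1(1), of 2] N by simp
  show "real N < 2 powr (nat \<lfloor>log 2 N\<rfloor> + 1)"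
    using powr_less_mono[OF 1(2), of 2] N by simp
qed

lemma slack_le:
  assumes "1 \<le> N"
  shows "real (slack N) \<le> 2 / e * real N powr p"
proof -
  have "2 powr (p * nat \<lfloor>log 2 N\<rfloor>) = (2 powr nat \<lfloor>log 2 N\<rfloor>) powr p"
    by (simp add: powr_powr mult.commute)
  also have "\<dots> \<le> real N powr p"
    by (rule powr_mono2) (use p_bounds floor_log_bounds[OF assms] in auto)
  finally have "2 / e * 2 powr (p * nat \<lfloor>log 2 N\<rfloor>) \<le> 2 / e * real N powr p"
    by (intro mult_left_mono) auto
  moreover have "real (slack N) \<le> 2 / e * 2 powr (p * nat \<lfloor>log 2 N\<rfloor>)"
    unfolding slack_def gap_def by (intro of_nat_floor) auto
  ultimately show ?thesis by simp
qed

text \<open>The power \<open>s powr p\<close> splits into the share \<open>1 - 2 / e\<close> for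
  nodes and \<open>2 / e\<close> for the gap.\<close>

lemma need_slack:
  assumes "1 \<le> s"
  shows "need s s + slack s \<le> size_bound s"
proof (cases "s = 1")
  case True
  \<comment> \<open>A single node has \<open>need\<close> 1 by the \<open>max\<close>, and its gap
    rounds down to 0.\<close>
  have "\<lfloor>1 - 2 / real e\<rfloor> = 0" "\<lfloor>2 / real e\<rfloor> = 0" using e16 by (auto intro!: floor_unique)
  then show ?thesis using True by (simp add: need_def slack_def gap_def size_bound_def)
next
  case False
  then have 2: "2 \<le> s" using assms by simp
  have x: "(1 - 2 / e) * s * real s powr (8 / e) = (1 - 2 / e) * real s powr p"
    by (simp add: powr_p)
  have "1 * 1 \<le> real s * ((1 - 2 / e) * real s powr (8 / e))"
    by (rule mult_mono) (use 2 sigma_powr[OF 2] in auto)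
  then have "1 \<le> (1 - 2 / e) * s * real s powr (8 / e)" by (simp add: mult_ac)
  then have "need s s = nat \<lfloor>(1 - 2 / e) * s * real s powr (8 / e)\<rfloor>"
    unfolding need_def by (intro max_absorb2) (simp add: le_nat_iff le_floor_iff)
  moreover have "real (nat \<lfloor>(1 - 2 / e) * s * real s powr (8 / e)\<rfloor>) \<le> (1 - 2 / e) * s * real s powr (8 / e)"
    by (intro of_nat_floor) (use e16 in auto)
  ultimately have "real (need s s + slack s) \<le> real s powr p"
    using slack_le[OF assms] unfolding x by (simp add: algebra_simps)
  then show ?thesis unfolding size_bound_def by (rule le_nat_floor)
qed

lemma need_mono: "s \<le> N \<Longrightarrow> need N s \<le> need N N"
  unfolding need_def using e16
  by (intro max.mono nat_mono floor_mono mult_right_mono mult_left_mono) auto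

text \<open>Take the largest multiple of \<open>g\<close> up to \<open>E\<close>; the remainder is
  at most the slack. The multiplier is at most \<open>2 * e\<close> because \<open>E\<close> is at
  most \<open>2 powr (p * (t + 1))\<close>, which is at most 4 times \<open>2 powr (p * t)\<close>,
  while \<open>g\<close> is at least \<open>2 / e\<close> times that.\<close>

lemma ex_extent:
  assumes "1 \<le> s" "s \<le> N" "N \<le> 2 ^ K"
  shows "\<exists>D\<in>extents. need N s \<le> D \<and> D \<le> need N s + slack N"
proof -
  define t where "t = nat \<lfloor>log 2 N\<rfloor>"
  define g where "g = Suc (slack N)"
  define E where "E = need N s + slack N"
  have N: "1 \<le> N" using assms by simp
  have "log 2 N \<le> log 2 (2 ^ K)" using assms(3) N
    by (intro log_mono) (simp_all flip: of_nat_power of_nat_le_iff)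
  then have t: "t \<le> K" unfolding t_def by (simp add: nat_le_iff floor_le_iff)
  have g: "g = Suc (gap t)" by (simp add: g_def slack_def t_def)
  have "real E \<le> real (size_bound N)" using need_slack[OF N] need_mono[OF assms(2)] by (simp add: E_def)
  also have "\<dots> \<le> real N powr p" unfolding size_bound_def by (rule of_nat_floor) simp
  also have "\<dots> \<le> (2 powr (t + 1)) powr p"
    by (rule powr_mono2) (use p_bounds floor_log_bounds[OF N] in \<open>auto simp: t_def\<close>)
  also have "\<dots> = 2 powr (p * t) * 2 powr p" by (simp add: powr_powr powr_add powr_mult mult.commute)
  also have "\<dots> \<le> 2 powr (p * t) * 2 powr 2"
    using p_bounds by (intro mult_left_mono powr_mono) auto
  also have "\<dots> = 2 * e * (2 / e * 2 powr (p * t))" using e_pos by simp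
  also have "\<dots> \<le> 2 * e * g"
    unfolding g gap_def of_nat_mult[of "2 * e"] by (rule mult_left_mono) linarith+
  finally have "E \<le> 2 * e * g" by (simp flip: of_nat_mult of_nat_le_iff)
  then have "E div g \<le> 2 * e" by (metis div_le_mono div_mult_self_is_m g_def zero_less_Suc)
  then have "E div g * g \<in> extents"
    unfolding extents_def using t by (auto simp: g intro!: image_eqI[of _ _ "(t, E div g)"])
  moreover have "E mod g < g" by (simp add: g_def)
  then have "need N s \<le> E div g * g"
    using div_mult_mod_eq[of E g] E_def g_def by linarith
  moreover have "E div g * g \<le> E" by simp
  ultimately show ?thesis unfolding E_def by blast
qed


text \<open>For \<open>N >= 2\<close> the density \<open>x\<close> is at least 1, the
  \<open>max\<close> is idle, and \<open>need N\<close> is the floor of a linear function; the real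
  inequality then passes to floors.\<close>

lemma need_add:
  assumes "2 \<le> N" "1 \<le> h" "real a \<le> (1 - 2 / e) * (1 + real S) * real N powr (8 / e)"
  shows "a + need N h \<le> need N (1 + h + S)"
proof -
  define x where "x = (1 - 2 / e) * real N powr (8 / e)"
  have x: "1 \<le> x" using sigma_powr[OF assms(1)] by (simp add: x_def)
  have eq: "need N k = nat \<lfloor>x * k\<rfloor>" if "1 \<le> k" for k
  proof -
    have "1 * 1 \<le> x * real k" by (rule mult_mono) (use x that in auto)
    then have "1 \<le> nat \<lfloor>x * k\<rfloor>" by (simp add: le_nat_iff le_floor_iff)
    then show ?thesis by (simp add: need_def x_def mult_ac)
  qed
  have "real (nat \<lfloor>x * h\<rfloor>) \<le> x * h" by (rule of_nat_floor) (use x in simp)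
  moreover have "real a \<le> x * (1 + real S)" using assms(3) by (simp add: x_def mult_ac)
  ultimately have "real (a + nat \<lfloor>x * h\<rfloor>) \<le> x * real (1 + h + S)" by (simp add: algebra_simps)
  then have "a + nat \<lfloor>x * h\<rfloor> \<le> nat \<lfloor>x * real (1 + h + S)\<rfloor>" by (rule le_nat_floor)
  then show ?thesis using eq[OF assms(2)] eq[of "1 + h + S"] by simp
qed

section \<open>Space for the light children of one node\<close>

lemma big_factor: "2 powr (p / e) * 2 powr (- (8 / e)) \<le> 1 - 5 / (2 * e)"
proof -
  \<comment> \<open>The first factor is the price of rounding a size up by
    \<open>2 powr (1 / e)\<close>, the second the gain from a light subtree having at most half the
    size.\<close>
  have "p / e \<le> 2 / e" using p_bounds e_pos by (simp add: divide_right_mono)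
  then have "2 powr (p / e) * 2 powr (- (8 / e)) \<le> 2 powr (2 / e) * 2 powr (- (8 / e))"
    by (intro mult_right_mono powr_mono) auto
  also have "\<dots> = 1 / 2 powr (6 / e)"
    by (simp flip: powr_add add: powr_minus_divide[symmetric])
  also have "\<dots> \<le> 1 / (1 + (6 / e) / 2)"
    by (intro divide_left_mono two_powr_ge mult_pos_pos) (auto intro: add_pos_nonneg)
  \<comment> \<open>True from \<open>e = 15\<close> on. The bound is \<open>1 - 2 / e\<close> less a
    reserve of \<open>1 / (2 * e)\<close> for the harmonic regions.\<close>
  also have "\<dots> \<le> 1 - 5 / (2 * e)"
    using e16 by (simp add: field_simps power2_eq_square)
  finally show ?thesis .
qed

text \<open>The power is \<open>(1 / 2 ^ (e * l)) powr (8 / e)\<close>, the saving on children below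
  the large classes. It beats the harmonic sum \<open>K + 1\<close> and the factor \<open>e\<close>,
  both at most \<open>2 ^ l\<close>.\<close>

lemma small_factor: "4 * (real K + 1) * 2 powr (- (8 * real l)) \<le> 1 / (2 * e)"
proof -
  have "16 \<le> (2 :: nat) ^ l" using e16 e_le by linarith
  then have l4: "4 \<le> l" using power_le_imp_le_exp[of 2 4 l] by simp
  have e: "real e \<le> 2 powr real l"
    unfolding two_powr_nat of_nat_le_iff by (rule e_le)
  have "real (K + 1) \<le> 2 powr real l"
    unfolding two_powr_nat of_nat_le_iff by (rule K_le)
  then have K: "real K + 1 \<le> 2 powr real l" by (simp only: of_nat_add of_nat_1)
  have "4 * (real K + 1) * (2 * e) \<le> 4 * 2 powr l * (2 * 2 powr l)"
    using e K by (intro mult_mono mult_left_mono) auto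
  also have "\<dots> = 2 powr 3 * (2 powr l * 2 powr l)" by simp
  also have "\<dots> = 2 powr (3 + real l + real l)" by (simp only: powr_add mult.assoc)
  also have "\<dots> \<le> 2 powr (8 * real l)" using l4 by (intro powr_mono) auto
  finally have "4 * (real K + 1) * (2 * e) \<le> 2 powr (8 * real l)" .
  then show ?thesis using e_pos by (simp add: powr_minus field_simps)
qed

text \<open>The first summand of the bound pays for children in large classes. The second pays for
  harmonic regions, and it is present for all \<open>i\<close> because the table goes on past the
  last child.\<close>

lemma ex_region:
  fixes s :: "nat \<Rightarrow> nat" and d :: nat
  defines "S \<equiv> \<Sum>i=1..d. s i"
  assumes mono: "\<And>i j. 1 \<le> i \<Longrightarrow> i \<le> j \<Longrightarrow> j \<le> d \<Longrightarrow> s j \<le> s i"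
    and S: "1 \<le> S" "S \<le> 2 ^ K"
  shows "\<exists>r\<in>regions. (\<forall>i\<in>{1..d}. size_bound (s i) \<le> r i) \<and>
     (\<forall>i\<ge>1. real (r i) \<le> (if i \<le> d then (2 powr (1 / e) * s i) powr p else 0)
          + (2 powr (1 / e) * S / max (2 ^ (e * l)) (real i)) powr p)"
proof -
  define \<tau> where "\<tau> = nat \<lceil>e * log 2 S\<rceil>"
  have logS: "0 \<le> e * log 2 S" using S by simp
  then have \<tau>: "e * log 2 S \<le> \<tau>" "\<tau> \<le> e * log 2 S + 1" unfolding \<tau>_def by linarith+
  have "log 2 S \<le> log 2 (2 ^ K)" using S
    by (intro log_mono) (simp_all flip: of_nat_power of_nat_le_iff)
  then have "e * log 2 S \<le> real (e * K)" using mult_left_mono[of "log 2 S" K e] by simp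
  then have "\<tau> \<le> e * K" unfolding \<tau>_def by (simp add: nat_le_iff ceiling_le_iff)
  \<comment> \<open>\<open>W r\<close> is the upper boundary of class \<open>r\<close>;
    \<open>W 0\<close> is \<open>S\<close> rounded up to a power of
    \<open>2 powr (1 / e)\<close>.\<close>
  define W where "W x = 2 powr ((real \<tau> - x) / e)" for x
  have "2 powr (log 2 S) \<le> W 0"
    unfolding W_def using \<tau>(1) e_pos by (intro powr_mono) (auto simp: field_simps)
  then have SW: "real S \<le> W 0" using S by simp
  have "W 0 \<le> 2 powr (1 / e + log 2 S)"
    unfolding W_def using \<tau>(2) e_pos by (intro powr_mono) (auto simp: field_simps)
  then have WS: "W 0 \<le> 2 powr (1 / e) * S" using S by (simp add: powr_add)
  define c where "c r = card {k \<in> {1..d}. W (real (Suc r)) < s k}" for r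
  have c: "i \<le> c r \<longleftrightarrow> i \<le> d \<and> W (real (Suc r)) < s i" if "1 \<le> i" for i r
    unfolding c_def by (rule antimono_upper_set[OF mono that])
  have c_le: "c r \<le> 2 ^ (e * l)" if "r < Q" for r
  proof -
    \<comment> \<open>The counted children each exceed \<open>W (Suc r)\<close> and together stay
      within \<open>W 0\<close>.\<close>
    have "real (c r) * W (real (Suc r)) = (\<Sum>k\<in>{k \<in> {1..d}. W (real (Suc r)) < s k}. W (real (Suc r)))"
      by (simp add: c_def)
    also have "\<dots> \<le> (\<Sum>k\<in>{k \<in> {1..d}. W (real (Suc r)) < s k}. real (s k))"
      by (rule sum_mono) simp
    also have "\<dots> \<le> (\<Sum>k=1..d. real (s k))" by (rule sum_mono2) auto
    also have "\<dots> \<le> W 0" using SW by (simp add: S_def)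
    also have "\<dots> = 2 powr (real (Suc r) / e) * W (real (Suc r))"
      by (simp add: W_def flip: powr_add add: diff_divide_distrib)
    finally have "real (c r) \<le> 2 powr (real (Suc r) / e)" by (simp add: W_def)
    also have "real (Suc r) \<le> real (e * (e * l))" using that unfolding Q_def of_nat_le_iff by simp
    then have "2 powr (real (Suc r) / e) \<le> 2 powr real (e * l)"
      using e_pos by (intro powr_mono) (auto simp: field_simps)
    finally have "real (c r) \<le> 2 powr real (e * l)" .
    then show ?thesis by (simp only: two_powr_nat of_nat_le_iff)
  qed
  define cs where "cs = map c [0..<Q]"
  have cs: "set cs \<subseteq> {..2 ^ (e * l)}" "length cs = Q" "\<And>r. r < Q \<Longrightarrow> cs ! r = c r"
    using c_le by (auto simp: cs_def)
  define r where "r = region \<tau> cs"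
  have r_in: "r \<in> regions" unfolding regions_def r_def
    using \<open>\<tau> \<le> e * K\<close> cs by (auto intro!: image_eqI[of _ _ "(\<tau>, cs)"])
  have r_i: "(i \<le> d \<longrightarrow> size_bound (s i) \<le> r i) \<and>
     real (r i) \<le> (if i \<le> d then (2 powr (1 / e) * s i) powr p else 0)
          + (2 powr (1 / e) * S / max (2 ^ (e * l)) (real i)) powr p" if i: "1 \<le> i" for i
  proof (cases "\<exists>r<Q. i \<le> cs ! r")
    case True
    define q where "q = (LEAST r. r < Q \<and> i \<le> cs ! r)"
    have q: "q < Q" "i \<le> c q" using LeastI_ex[OF True] cs(3)[of q] by (auto simp: q_def)
    have low: "i \<le> d" "W (real (Suc q)) < s i" using q c[OF i] by auto
    \<comment> \<open>Minimality of \<open>q\<close> puts child \<open>i\<close> in class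
      \<open>q\<close>, between \<open>W (Suc q)\<close> and \<open>W q\<close>.\<close>
    have "real (s i) \<le> W (real q)"
    proof (cases q)
      case 0
      have "s i \<le> S" unfolding S_def by (rule member_le_sum) (use i low in auto)
      then show ?thesis using SW 0 by simp
    next
      case (Suc q')
      then have "\<not> (q' < Q \<and> i \<le> cs ! q')"
        using not_less_Least[of q' "\<lambda>r. r < Q \<and> i \<le> cs ! r"] by (auto simp: q_def)
      then have "\<not> i \<le> c q'" using q Suc cs(3) by auto
      then show ?thesis using c[OF i] low Suc by auto
    qed
    moreover have "W (real q) = 2 powr (1 / e) * W (real (Suc q))"
      by (simp add: W_def flip: powr_add add: diff_divide_distrib add_divide_distrib)
    then have "W (real q) \<le> 2 powr (1 / e) * s i" using low by simp
    moreover have r: "r i = nat \<lfloor>W (real q) powr p\<rfloor>"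
      unfolding r_def region_def W_def q_def using True by simp
    moreover have "0 \<le> W (real q)" by (simp add: W_def)
    ultimately have "size_bound (s i) \<le> r i" "W (real q) powr p \<le> (2 powr (1 / e) * s i) powr p"
      unfolding size_bound_def r using p_bounds
      by (auto intro!: nat_mono floor_mono powr_mono2)
    moreover have "real (r i) \<le> W (real q) powr p" unfolding r by (rule of_nat_floor) simp
    ultimately show ?thesis using low by (simp add: add_increasing2)
  next
    case False
    let ?m = "max (2 ^ (e * l)) (real i)"
    have m: "0 < ?m" by (simp add: less_max_iff_disj)
    have r: "r i = nat \<lfloor>(W 0 / ?m) powr p\<rfloor>"
      unfolding r_def region_def W_def if_not_P[OF False] by simp
    have "real (s i) \<le> W 0 / ?m" if "i \<le> d"
    proof -
      have "l \<noteq> 0" using e_le e16 by (cases "l = 0") auto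
      then have Q: "0 < Q" using e_pos by (simp add: Q_def)
      then have "Q - 1 < Q" by simp
      then have "\<not> i \<le> c (Q - 1)" using False cs(3) by metis
      then have "real (s i) \<le> W (real Q)" using c[OF i] that Q by auto
      also have "\<dots> = W 0 / 2 powr (e * l)"
        using e_pos by (simp add: W_def Q_def flip: powr_diff add: diff_divide_distrib)
      also have "\<dots> = W 0 / 2 ^ (e * l)" by (simp only: powr_realpow)
      finally have 1: "real (s i) * 2 ^ (e * l) \<le> W 0" by (simp add: field_simps)
      \<comment> \<open>The first \<open>i\<close> children are at least as large as the
        \<open>i\<close>-th and share \<open>S\<close>, which bounds \<open>s i\<close> by
        \<open>S / i\<close>.\<close>
      have "i * s i = (\<Sum>k=1..i. s i)" by simp
      also have "\<dots> \<le> (\<Sum>k=1..i. s k)" by (rule sum_mono) (use mono that in auto)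
      also have "\<dots> \<le> S" unfolding S_def by (rule sum_mono2) (use that in auto)
      finally have "real (s i) * real i \<le> W 0" using SW by (simp flip: of_nat_mult add: mult.commute)
      then have "real (s i) * ?m \<le> W 0" using 1 by (simp add: max_def)
      then show ?thesis using m by (simp add: field_simps)
    qed
    then have "i \<le> d \<longrightarrow> size_bound (s i) \<le> r i"
      unfolding r size_bound_def using p_bounds by (auto intro!: nat_mono floor_mono powr_mono2)
    moreover have "real (r i) \<le> (W 0 / ?m) powr p" unfolding r by (rule of_nat_floor) simp
    moreover have "(W 0 / ?m) powr p \<le> (2 powr (1 / e) * S / ?m) powr p"
      using p_bounds m WS by (intro powr_mono2 divide_right_mono) (auto simp: W_def)
    ultimately show ?thesis by (auto intro: add_increasing)
  qed
  show ?thesis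
  proof (rule bexI[OF _ r_in], intro conjI ballI allI impI)
    show "size_bound (s i) \<le> r i" if "i \<in> {1..d}" for i using r_i[of i] that by simp
  qed (use r_i in blast)
qed


text \<open>With \<open>M = N powr (8 / e)\<close>, large classes cost at most
  \<open>(1 - 5 / (2 * e)) * M * S\<close> and harmonic regions at most
  \<open>1 / (2 * e) * M * S\<close>. The sum \<open>(1 - 2 / e) * M * S\<close> is what
  \<open>need N\<close> grants to \<open>S\<close> nodes.\<close>

lemma ex_layout:
  fixes s :: "nat \<Rightarrow> nat" and d :: nat
  assumes N: "N \<le> 2 ^ K"
    and s: "\<And>i. i \<in> {1..d} \<Longrightarrow> 1 \<le> s i \<and> s i \<le> h"
    and mono: "\<And>i j. 1 \<le> i \<Longrightarrow> i \<le> j \<Longrightarrow> j \<le> d \<Longrightarrow> s j \<le> s i"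
    and sum: "1 + h + (\<Sum>i=1..d. s i) \<le> N"
  shows "\<exists>r\<in>regions. (\<forall>i\<in>{1..d}. size_bound (s i) \<le> r i) \<and>
    1 + (\<Sum>i=1..2 ^ K. r i) + (if h = 0 then 0 else need N h) \<le> need N (1 + h + (\<Sum>i=1..d. s i))"
proof (cases "d = 0")
  case True
  have "1 + (if h = 0 then 0 else need N h) \<le> need N (1 + h)"
  proof (cases "h = 0")
    case False
    then show ?thesis using need_add[of N h 1 0] sigma_powr[of N] sum True by simp
  qed (simp add: need_def)
  then show ?thesis using True by (intro bexI[of _ "\<lambda>_. 0"]) (auto simp: regions_def)
next
  case False
  define S where "S = (\<Sum>i=1..d. s i)"
  define \<alpha> where "\<alpha> = 8 / real e"
  define M where "M = real N powr \<alpha>"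
  have \<alpha>: "0 \<le> \<alpha>" "\<alpha> \<le> 1" using e16 by (auto simp: \<alpha>_def)
  have "s 1 \<le> S" unfolding S_def by (rule member_le_sum) (use False in auto)
  then have S: "1 \<le> S" "1 \<le> h" "2 \<le> N" "S \<le> N" using s[of 1] False sum by (auto simp: S_def)
  obtain r where r: "r \<in> regions" "\<forall>i\<in>{1..d}. size_bound (s i) \<le> r i"
    "\<And>i. 1 \<le> i \<Longrightarrow> real (r i) \<le> (if i \<le> d then (2 powr (1 / e) * s i) powr p else 0)
          + (2 powr (1 / e) * S / max (2 ^ (e * l)) (real i)) powr p"
    using ex_region[of d s, OF mono] S N unfolding S_def[symmetric] by auto
  \<comment> \<open>A light child has at most the size of the heavy one, so twice its size is at
    most \<open>N\<close>.\<close>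
  have big: "(2 powr (1 / e) * s i) powr p \<le> (1 - 5 / (2 * e)) * M * s i" if "i \<in> {1..d}" for i
  proof -
    have "s i \<le> S" unfolding S_def by (rule member_le_sum) (use that in auto)
    then have "2 * s i \<le> N" using s[OF that] sum by (simp add: S_def)
    then have "real (s i) \<le> real N / 2" by simp
    then have "real (s i) powr \<alpha> \<le> (real N / 2) powr \<alpha>" using \<alpha> by (intro powr_mono2) auto
    also have "\<dots> = M * 2 powr (- \<alpha>)" by (simp add: M_def powr_divide powr_minus_divide)
    finally have "2 powr (p / e) * (s i * real (s i) powr \<alpha>) \<le> 2 powr (p / e) * (s i * (M * 2 powr (- \<alpha>)))"
      by (intro mult_left_mono) auto
    also have "\<dots> = (2 powr (p / e) * 2 powr (- (8 / e))) * (M * s i)" by (simp add: \<alpha>_def)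
    also have "\<dots> \<le> (1 - 5 / (2 * e)) * (M * s i)"
      by (intro mult_right_mono big_factor) (simp add: M_def)
    finally show ?thesis by (simp add: powr_mult powr_powr powr_p \<alpha>_def mult.assoc)
  qed
  \<comment> \<open>Write \<open>x powr p\<close> as \<open>x * x powr \<alpha>\<close> and use both
    arguments of the \<open>max\<close>: \<open>real i\<close> in the first factor makes the sum
    harmonic, \<open>2 ^ (e * l)\<close> in the second gives the saving.\<close>
  have small: "(2 powr (1 / e) * S / max (2 ^ (e * l)) (real i)) powr p
      \<le> (4 * 2 powr (- (8 * real l)) * M * S) * (1 / i)" if "1 \<le> i" for i
  proof -
    let ?x = "2 powr (1 / e) * S / max (2 ^ (e * l)) (real i)"
    have "2 powr (1 / e) \<le> 2 powr 1" using e16 by (intro powr_mono) auto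
    then have 2: "2 powr (1 / e) * S \<le> 2 * real S" by (simp add: mult_right_mono)
    then have xi: "?x \<le> 2 * S / i" using that by (intro frac_le) auto
    have "?x \<le> (2 * N) / 2 ^ (e * l)" using 2 S(4) by (intro frac_le) auto
    then have "?x powr \<alpha> \<le> ((2 * N) / 2 ^ (e * l)) powr \<alpha>"
      using \<alpha> by (intro powr_mono2) auto
    also have "\<dots> = 2 powr \<alpha> * M * (1 / (2 powr (e * l)) powr \<alpha>)"
      by (simp add: M_def powr_divide powr_mult powr_realpow[symmetric])
    also have "(2 powr (e * l)) powr \<alpha> = 2 powr (8 * real l)"
      using e_pos by (simp add: powr_powr \<alpha>_def mult.commute)
    also have "2 powr \<alpha> * M * (1 / 2 powr (8 * real l)) \<le> 2 powr 1 * M * (1 / 2 powr (8 * real l))"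
      using \<alpha> by (intro mult_right_mono powr_mono) (auto simp: M_def)
    also have "\<dots> = 2 * 2 powr (- (8 * real l)) * M" by (simp add: powr_minus_divide)
    finally have "?x * ?x powr \<alpha> \<le> (2 * S / i) * (2 * 2 powr (- (8 * real l)) * M)"
      by (intro mult_mono xi) (auto intro!: divide_nonneg_nonneg simp: le_max_iff_disj)
    moreover have "?x powr p = ?x * ?x powr \<alpha>"
      unfolding \<alpha>_def by (rule powr_p) (auto intro!: divide_nonneg_nonneg simp: le_max_iff_disj)
    ultimately show ?thesis by (simp add: mult_ac)
  qed
  have filter: "(\<Sum>i=1..2 ^ K. if i \<le> d then g i else 0) = sum g {i\<in>{1..2 ^ K}. i \<le> d}"
    for g :: "nat \<Rightarrow> real" by (rule sum.inter_filter[symmetric]) simp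
  have "real (\<Sum>i=1..2 ^ K. r i) \<le> (\<Sum>i=1..2 ^ K.
      (if i \<le> d then (2 powr (1 / e) * s i) powr p else 0) + (4 * 2 powr (- (8 * real l)) * M * S) * (1 / i))"
    unfolding of_nat_sum
  proof (rule sum_mono)
    fix i :: nat assume "i \<in> {1..2 ^ K}"
    then show "real (r i) \<le> (if i \<le> d then (2 powr (1 / e) * s i) powr p else 0)
      + (4 * 2 powr (- (8 * real l)) * M * S) * (1 / i)" using r(3)[of i] small[of i] by simp
  qed
  also have "\<dots> = (\<Sum>i\<in>{i\<in>{1..2 ^ K}. i \<le> d}. (2 powr (1 / e) * s i) powr p)
      + (4 * 2 powr (- (8 * real l)) * M * S) * (\<Sum>i=1..2 ^ K. 1 / real i)"
    by (simp only: sum.distrib sum_distrib_left filter)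
  also have "(\<Sum>i\<in>{i\<in>{1..2 ^ K}. i \<le> d}. (2 powr (1 / e) * s i) powr p) \<le> (\<Sum>i=1..d. (2 powr (1 / e) * s i) powr p)"
    by (rule sum_mono2) auto
  also have "\<dots> \<le> (\<Sum>i=1..d. (1 - 5 / (2 * e)) * M * s i)" by (rule sum_mono[OF big])
  also have "\<dots> = (1 - 5 / (2 * e)) * (M * S)" by (simp add: S_def sum_distrib_left mult.assoc)
  also have "(4 * 2 powr (- (8 * real l)) * M * S) * (\<Sum>i=1..2 ^ K. 1 / real i)
      \<le> (4 * 2 powr (- (8 * real l)) * M * S) * (real K + 1)"
    by (rule mult_left_mono[OF harmonic_le]) (simp add: M_def)
  also have "\<dots> = (4 * (real K + 1) * 2 powr (- (8 * real l))) * (M * S)" by simp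
  also have "\<dots> \<le> 1 / (2 * e) * (M * S)"
    by (rule mult_right_mono[OF small_factor]) (simp add: M_def)
  also have "(1 - 5 / (2 * e)) * (M * S) + 1 / (2 * e) * (M * S) = (1 - 2 / e) * S * M"
    using e_pos by (simp add: field_simps)
  finally have "real (\<Sum>i=1..2 ^ K. r i) \<le> (1 - 2 / e) * S * M" by simp
  moreover have "1 \<le> (1 - 2 / e) * M" using sigma_powr[OF S(3)] by (simp add: M_def \<alpha>_def)
  ultimately have "real (1 + (\<Sum>i=1..2 ^ K. r i)) \<le> (1 - 2 / e) * M + (1 - 2 / e) * S * M"
    unfolding of_nat_add of_nat_1 by linarith
  also have "\<dots> = (1 - 2 / e) * (1 + real S) * real N powr (8 / e)"
    unfolding M_def \<alpha>_def distrib_left distrib_right by simp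
  finally have "real (1 + (\<Sum>i=1..2 ^ K. r i)) \<le> (1 - 2 / e) * (1 + real S) * real N powr (8 / e)" .
  then have "1 + (\<Sum>i=1..2 ^ K. r i) + need N h \<le> need N (1 + h + S)"
    by (rule need_add[OF S(3,2)])
  then show ?thesis using r(1,2) S(2) unfolding S_def by auto
qed

section \<open>Counting labels, and the scheme for fixed parameters\<close>

definition label_bits :: nat where
  "label_bits = K + 8 * K div e + 4 + 4 * l + 2 * (e ^ 3 * l ^ 2)"

definition labels :: "(nat \<times> nat \<times> (nat \<Rightarrow> nat)) set" where
  "labels = {..<2 ^ (K + 8 * K div e + 1)} \<times> (extents \<times> regions)"

lemma card_extents: "finite extents" "card extents \<le> 2 ^ (2 * l + 2)"
proof -
  show "finite extents" by (simp add: extents_def)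
  have "card extents \<le> card ({..K} \<times> {..2 * e})"
    unfolding extents_def by (rule card_image_le) simp
  also have "\<dots> = (K + 1) * (2 * e + 1)" by (simp add: card_cartesian_product)
  also have "\<dots> \<le> 2 ^ l * (4 * 2 ^ l)" by (rule mult_mono) (use K_le e_le e_pos in auto)
  also have "\<dots> = 2 ^ (2 * l + 2)" by (simp add: power_add mult_2)
  finally show "card extents \<le> 2 ^ (2 * l + 2)" .
qed

text \<open>A list has \<open>Q = e * e * l\<close> counts of at most \<open>e * l + 1\<close> bits
  each, \<open>\<tau>\<close> takes \<open>2 * l\<close> bits, and the last bit absorbs the zero
  function.\<close>

lemma card_regions: "finite regions" "card regions \<le> 2 ^ (2 * l + 2 * (e ^ 3 * l ^ 2) + 1)"
proof -
  let ?C = "{c. set c \<subseteq> {..2 ^ (e * l)} \<and> length c = Q} :: nat list set"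
  have C: "finite ?C" "card ?C = (2 ^ (e * l) + 1) ^ Q"
    using finite_lists_length_eq[of "{..2 ^ (e * l) :: nat}" Q]
      card_lists_length_eq[of "{..2 ^ (e * l) :: nat}" Q] by auto
  then show "finite regions" by (simp add: regions_def)
  have l: "1 \<le> e * l" using e_pos e_le e16 by (cases "l = 0") auto
  have "card ?C \<le> (2 ^ (e * l + 1)) ^ Q" unfolding C by (rule power_mono) auto
  also have "\<dots> = 2 ^ ((e * l + 1) * Q)" by (rule power_mult[symmetric])
  also have "\<dots> \<le> 2 ^ (2 * (e ^ 3 * l ^ 2))"
  proof (rule power_increasing)
    have "(e * l + 1) * Q \<le> (2 * (e * l)) * Q" using l by (intro mult_right_mono) auto
    then show "(e * l + 1) * Q \<le> 2 * (e ^ 3 * l ^ 2)"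
      by (simp add: Q_def power2_eq_square power3_eq_cube mult_ac)
  qed simp
  finally have C_le: "card ?C \<le> 2 ^ (2 * (e ^ 3 * l ^ 2))" .
  have "e * K + 1 \<le> e * (K + 1)" using e_pos by simp
  also have "\<dots> \<le> 2 ^ l * 2 ^ l" by (rule mult_mono[OF e_le K_le]) auto
  finally have eK: "e * K + 1 \<le> 2 ^ (2 * l)" by (simp add: mult_2 power_add)
  have "card regions \<le> Suc (card ((\<lambda>(\<tau>, c). region \<tau> c) ` ({..e * K} \<times> ?C)))"
    unfolding regions_def by (rule card_insert_le_m1[THEN le_trans]) (auto simp: C)
  also have "\<dots> \<le> Suc (card ({..e * K} \<times> ?C))"
    using C by (intro Suc_leI le_imp_less_Suc card_image_le) auto
  also have "\<dots> = Suc ((e * K + 1) * card ?C)" by (simp add: card_cartesian_product)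
  also have "\<dots> \<le> Suc (2 ^ (2 * l) * 2 ^ (2 * (e ^ 3 * l ^ 2)))"
    by (intro Suc_le_mono[THEN iffD2] mult_mono eK C_le) auto
  also have "\<dots> \<le> 2 ^ (2 * l + 2 * (e ^ 3 * l ^ 2)) + 2 ^ (2 * l + 2 * (e ^ 3 * l ^ 2))"
    by (simp add: power_add)
  finally show "card regions \<le> 2 ^ (2 * l + 2 * (e ^ 3 * l ^ 2) + 1)" by simp
qed

text \<open>The exponents for position, extent and region table add up to \<open>label_bits\<close>;
  its 4 collects their constants 1, 2 and 1.\<close>

lemma card_labels: "finite labels" "card labels \<le> 2 ^ label_bits"
proof -
  show "finite labels" by (simp add: labels_def card_extents card_regions)
  have "card labels = 2 ^ (K + 8 * K div e + 1) * (card extents * card regions)"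
    by (simp add: labels_def card_cartesian_product)
  also have "\<dots> \<le> 2 ^ (K + 8 * K div e + 1) * (2 ^ (2 * l + 2) * 2 ^ (2 * l + 2 * (e ^ 3 * l ^ 2) + 1))"
    by (intro mult_mono card_extents card_regions) auto
  also have "\<dots> = 2 ^ label_bits"
    unfolding label_bits_def power_add[symmetric] by (rule arg_cong[of _ _ "power 2"]) simp
  finally show "card labels \<le> 2 ^ label_bits" .
qed

lemma need_less: "1 \<le> n \<Longrightarrow> n \<le> 2 ^ K \<Longrightarrow> need n n \<le> 2 ^ (K + 8 * K div e + 1)"
proof -
  assume n: "1 \<le> n" "n \<le> 2 ^ K"
  \<comment> \<open>The spare bit pays for the rounding in \<open>8 * K div e\<close>.\<close>
  have "real (8 * K) / e \<le> real (8 * K div e) + 1"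
    using floor_divide_of_nat_eq[of "8 * K" e, where ?'a = real] by linarith
  then have *: "K * p \<le> K + 8 * K div e + 1" by (simp add: p_def algebra_simps)
  have "real (need n n) \<le> real (size_bound n)" using need_slack[OF n(1)] by simp
  also have "\<dots> \<le> real n powr p" unfolding size_bound_def by (rule of_nat_floor) simp
  also have "real n \<le> 2 powr real K" unfolding two_powr_nat of_nat_le_iff by (rule n(2))
  then have "real n powr p \<le> (2 powr K) powr p" using p_bounds by (intro powr_mono2) auto
  also have "\<dots> \<le> 2 powr real (K + 8 * K div e + 1)"
    unfolding powr_powr using * by (intro powr_mono) auto
  finally show ?thesis unfolding two_powr_nat of_nat_le_iff .
qed

text \<open>The set \<open>labels\<close> does not depend on the tree, so one injection into bit
  strings of length \<open>label_bits\<close> can be fixed in advance and inverted by the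
  decoder.\<close>

lemma ex_scheme:
  "\<exists>dec :: bool list \<Rightarrow> bool list \<Rightarrow> nat. \<forall>n par. is_rooted_tree n par \<longrightarrow> n \<le> 2 ^ K \<longrightarrow>
    (\<exists>lab port. canonical_ports n par port
      \<and> (\<forall>u<n. \<forall>w<n. u \<noteq> w \<longrightarrow> dec (lab u) (lab w) = next_hop n par port u w)
      \<and> (\<forall>u<n. length (lab u) = label_bits))"
proof -
  let ?B = "{xs :: bool list. set xs \<subseteq> UNIV \<and> length xs = label_bits}"
  have B: "finite ?B" "card ?B = 2 ^ label_bits"
    using finite_lists_length_eq[of "UNIV :: bool set" label_bits]
      card_lists_length_eq[of "UNIV :: bool set" label_bits] by simp_all
  have "card labels \<le> card ?B" using card_labels(2) B(2) by simp
  from card_le_inj[OF card_labels(1) B(1) this]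
  obtain f where f: "f ` labels \<subseteq> ?B" "inj_on f labels" by blast
  define dec where "dec x y = (let a = inv_into labels f x; b = inv_into labels f y
      in decode (2 ^ K) (snd a) (int (fst b) - int (fst a)))" for x y
  have "\<exists>lab port. canonical_ports n par port
      \<and> (\<forall>u<n. \<forall>w<n. u \<noteq> w \<longrightarrow> dec (lab u) (lab w) = next_hop n par port u w)
      \<and> (\<forall>u<n. length (lab u) = label_bits)" if tree: "is_rooted_tree n par" and n: "n \<le> 2 ^ K" for n par
  proof -
    \<comment> \<open>\<open>J\<close> is \<open>2 ^ K\<close> and not \<open>n\<close>, since the
      decoder has to know it.\<close>
    interpret layout n par "2 ^ K" extents regions size_bound need slack
    proof (unfold_locales, goal_cases)
      case 1
      show ?case by (rule tree)
    next
      case 2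
      show ?case by (rule n)
    next
      case 3
      then show ?case by (rule ex_layout)
    next
      case 4
      then show ?case by (intro need_slack)
    next
      case 5
      then show ?case by (rule ex_extent)
    qed
    from ex_labelling obtain port lab where lab: "canonical_ports n par port"
      "\<forall>u<n. lab u \<in> {..<need n n} \<times> (extents \<times> regions)"
      "\<forall>u<n. \<forall>w<n. u \<noteq> w \<longrightarrow>
          decode (2 ^ K) (snd (lab u)) (int (fst (lab w)) - int (fst (lab u))) = next_hop n par port u w"
      by (elim exE conjE) (rule that)
    have "1 \<le> n" using tree by (simp add: is_rooted_tree_def)
    then have "{..<need n n} \<subseteq> {..<2 ^ (K + 8 * K div e + 1)}" using need_less n by simp
    then have "{..<need n n} \<times> (extents \<times> regions) \<subseteq> labels"
      unfolding labels_def by (intro Sigma_mono) simp_all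
    then have l: "lab u \<in> labels" if "u < n" for u
      using lab(2) that by (meson subsetD)
    have "dec (f (lab u)) (f (lab w)) = next_hop n par port u w" if "u < n" "w < n" "u \<noteq> w" for u w
      using that lab(3) by (simp add: dec_def inv_into_f_f[OF f(2) l])
    moreover have "length (f (lab u)) = label_bits" if "u < n" for u using l[OF that] f(1) by auto
    ultimately show ?thesis
      using lab(1) by (intro exI[of _ "\<lambda>u. f (lab u)"] exI[of _ port]) simp
  qed
  then show ?thesis by (intro exI[of _ dec] allI impI)
qed

end

section \<open>Choice of parameters, asymptotics, and the final scheme\<close>

definition scheme_l :: "nat \<Rightarrow> nat" where
  "scheme_l K = nat \<lceil>log 2 (real K + 16)\<rceil>"

text \<open>The maximum with 16 keeps the assumptions of \<open>parameters\<close> true for small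
  \<open>K\<close>, since routing has to be correct for every tree.\<close>

definition scheme_e :: "nat \<Rightarrow> nat" where
  "scheme_e K = max 16 (nat \<lceil>real K powr (1/4) / sqrt (scheme_l K)\<rceil>)"

lemma scheme_l_bounds:
  "real K + 16 \<le> 2 ^ scheme_l K" "real (scheme_l K) \<le> log 2 (real K + 16) + 1" "1 \<le> scheme_l K"
proof -
  have 0: "0 < log 2 (real K + 16)" by simp
  then have 1: "log 2 (real K + 16) \<le> real (scheme_l K)" unfolding scheme_l_def by linarith
  show "real (scheme_l K) \<le> log 2 (real K + 16) + 1" unfolding scheme_l_def using 0 by linarith
  show "1 \<le> scheme_l K" using 0 1 by linarith
  have "real K + 16 = 2 powr (log 2 (real K + 16))" by simp
  also have "\<dots> \<le> 2 powr real (scheme_l K)" using 1 by (intro powr_mono) auto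
  finally show "real K + 16 \<le> 2 ^ scheme_l K" unfolding two_powr_nat by simp
qed

interpretation parameters K "scheme_e K" "scheme_l K" for K
proof
  \<comment> \<open>The shift by 16 in \<open>scheme_l\<close> lets \<open>2 ^ l\<close> bound both
    \<open>K + 1\<close> and the least value 16 of \<open>e\<close>.\<close>
  have l: "K + 16 \<le> 2 ^ scheme_l K"
    using scheme_l_bounds(1)[of K] by (metis of_nat_add of_nat_le_iff of_nat_numeral of_nat_power)
  show "16 \<le> scheme_e K" by (simp add: scheme_e_def)
  show "K + 1 \<le> 2 ^ scheme_l K" using l by simp
  have "nat \<lceil>real K powr (1/4) / sqrt (scheme_l K)\<rceil> \<le> K"
  proof (cases "K = 0")
    case False
    have "real K powr (1/4) / sqrt (scheme_l K) \<le> real K powr (1/4) / 1"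
      using scheme_l_bounds(3)[of K] by (intro divide_left_mono) auto
    also have "\<dots> \<le> real K" using powr_mono[of "1/4" 1 "real K"] False by simp
    finally show ?thesis using False by (simp add: nat_le_iff ceiling_le_iff)
  qed simp
  then show "scheme_e K \<le> 2 ^ scheme_l K"
    unfolding scheme_e_def using l by (intro max.boundedI) linarith+
qed

text \<open>The hypothesis makes the maximum with 16 idle and rounding up at most a doubling. With
  \<open>x <= e <= 2 * x\<close>, the term \<open>8 * K / e\<close> contributes 8 and
  \<open>2 * e ^ 3 * l ^ 2\<close> contributes 16 to the constant 24.\<close>

lemma label_bits_le:
  assumes "16 \<le> real K powr (1/4) / sqrt (scheme_l K)"
  shows "real (label_bits K)
    \<le> K + 24 * real K powr (3/4) * sqrt (scheme_l K) + 4 + 4 * scheme_l K"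
proof -
  define e l where "e = scheme_e K" and "l = scheme_l K"
  define x where "x = real K powr (1/4) / sqrt l"
  have l: "1 \<le> l" using scheme_l_bounds(3) by (simp add: l_def)
  have x: "16 \<le> x" using assms by (simp add: x_def l_def)
  have "real e = real_of_int \<lceil>x\<rceil>" using x unfolding e_def scheme_e_def x_def l_def by linarith
  then have e: "x \<le> e" "e \<le> 2 * x" using x by linarith+
  have sq: "sqrt l * sqrt l = l" "0 < sqrt l" using l by auto
  have K: "0 < K" using x by (cases "K = 0") (auto simp: x_def)
  have q: "real K powr (3/4) * real K powr (1/4) = K"
    using K by (simp flip: powr_add)
  have q3: "(real K powr (1/4)) ^ 3 = real K powr (3/4)" using K by (simp add: powr_power)
  have "real (8 * K div e) \<le> real (8 * K) / e" by (rule of_nat_div_le_of_nat)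
  also have "\<dots> = 8 * real K / e" by simp
  also have "\<dots> \<le> 8 * real K / x" using e x by (intro divide_left_mono) auto
  also have "\<dots> = 8 * (real K powr (3/4) * real K powr (1/4)) / x" by (simp only: q)
  also have "\<dots> = 8 * (real K powr (3/4) * sqrt l)" using K by (simp add: x_def)
  finally have 1: "real (8 * K div e) \<le> 8 * (real K powr (3/4) * sqrt l)" .
  have "real e ^ 3 * real l ^ 2 \<le> (2 * x) ^ 3 * real l ^ 2"
    using e by (intro mult_right_mono power_mono) auto
  also have "\<dots> = 8 * real K powr (3/4) * (real l ^ 2 / sqrt l ^ 3)"
    by (simp add: x_def power_mult_distrib power_divide q3)
  also have "real l ^ 2 / sqrt l ^ 3 = sqrt l"
    using sq by (simp add: field_simps power2_eq_square power3_eq_cube)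
  finally have 2: "real e ^ 3 * real l ^ 2 \<le> 8 * (real K powr (3/4) * sqrt l)" by simp
  have "real (label_bits K) = K + real (8 * K div e) + 4 + 4 * l + 2 * (real e ^ 3 * real l ^ 2)"
    by (simp add: label_bits_def e_def l_def)
  then show ?thesis using 1 2 unfolding e_def l_def by simp
qed


lemma label_bits_asymptotic:
  "\<exists>C n0. \<forall>n\<ge>n0. real (label_bits (nat \<lceil>log 2 (real n)\<rceil>))
    \<le> log 2 (real n) + C * log 2 (real n) powr (3/4) * sqrt (log 2 (log 2 (real n)))"
proof -
  \<comment> \<open>All growth conditions are put in terms of one real variable
    \<open>L = log 2 n\<close>, using \<open>K <= L + 1\<close>. The step from 24 to 30 absorbs the
    lower-order terms.\<close>
  define P where "P L \<longleftrightarrow> 1 \<le> L \<and> 16 \<le> L powr (1/4) / sqrt (log 2 (L + 17) + 1) \<and>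
      1 + 24 * (L + 1) powr (3/4) * sqrt (log 2 (L + 17) + 1) + 4 + 4 * (log 2 (L + 17) + 1)
      \<le> 30 * L powr (3/4) * sqrt (log 2 L)" for L :: real
  have "eventually P at_top"
    unfolding P_def by (intro eventually_conj; real_asymp)
  moreover have "filterlim (\<lambda>n. log 2 (real n)) at_top sequentially" by real_asymp
  ultimately have "eventually (\<lambda>n. P (log 2 (real n))) sequentially"
    by (rule eventually_compose_filterlim)
  then obtain n0 where n0: "\<And>n. n0 \<le> n \<Longrightarrow> P (log 2 (real n))"
    by (auto simp: eventually_sequentially)
  have "real (label_bits (nat \<lceil>log 2 (real n)\<rceil>))
    \<le> log 2 (real n) + 30 * log 2 (real n) powr (3/4) * sqrt (log 2 (log 2 (real n)))"
    if "n0 \<le> n" for n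
  proof -
    define L where "L = log 2 (real n)"
    define K where "K = nat \<lceil>L\<rceil>"
    note P = n0[OF that, folded L_def, unfolded P_def]
    have K: "L \<le> K" "K \<le> L + 1" using P unfolding K_def by linarith+
    have "real (scheme_l K) \<le> log 2 (real K + 16) + 1" by (rule scheme_l_bounds)
    also have "\<dots> \<le> log 2 (L + 17) + 1" using K by simp
    finally have l: "real (scheme_l K) \<le> log 2 (L + 17) + 1" .
    have "16 \<le> L powr (1/4) / sqrt (log 2 (L + 17) + 1)" using P by simp
    also have "\<dots> \<le> real K powr (1/4) / sqrt (scheme_l K)"
      using P K l scheme_l_bounds(3)[of K] by (intro frac_le powr_mono2) auto
    finally have "real (label_bits K)
        \<le> K + 24 * real K powr (3/4) * sqrt (scheme_l K) + 4 + 4 * scheme_l K"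
      by (rule label_bits_le)
    also have "\<dots> \<le> (L + 1) + 24 * (L + 1) powr (3/4) * sqrt (log 2 (L + 17) + 1)
        + 4 + 4 * (log 2 (L + 17) + 1)"
      using P K l by (intro add_mono mult_mono powr_mono2) auto
    also have "\<dots> \<le> L + 30 * L powr (3/4) * sqrt (log 2 L)" using P by simp
    finally show ?thesis unfolding K_def L_def .
  qed
  then show ?thesis by blast
qed

lemma le_two_power_ceil_log:
  assumes "1 \<le> n"
  shows "n \<le> 2 ^ nat \<lceil>log 2 (real n)\<rceil>"
proof -
  have "0 \<le> log 2 (real n)" using assms by simp
  then have "log 2 (real n) \<le> real (nat \<lceil>log 2 (real n)\<rceil>)" by linarith
  then have "2 powr log 2 (real n) \<le> 2 powr real (nat \<lceil>log 2 (real n)\<rceil>)" by (intro powr_mono) auto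
  then have "real n \<le> 2 powr real (nat \<lceil>log 2 (real n)\<rceil>)" using assms by simp
  then show ?thesis unfolding two_powr_nat of_nat_le_iff .
qed

theorem mainTheorem2:
  shows "\<exists>(enc :: nat \<Rightarrow> (nat \<Rightarrow> nat) \<Rightarrow> (nat \<Rightarrow> bool list) \<times> (nat \<Rightarrow> nat))
            (dec :: nat \<Rightarrow> bool list \<Rightarrow> bool list \<Rightarrow> nat) (C :: real) (n0 :: nat).
     \<forall>n par. is_rooted_tree n par \<longrightarrow>
       (let lab = fst (enc n par); port = snd (enc n par) in
          canonical_ports n par port
        \<and> (\<forall>u<n. \<forall>w<n. u \<noteq> w \<longrightarrow>
              dec (nat \<lceil>log 2 (real n)\<rceil>) (lab u) (lab w) = next_hop n par port u w)
        \<and> (n0 \<le> n \<longrightarrow> (\<forall>u<n. real (length (lab u))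
              \<le> log 2 (real n) + C * (log 2 (real n)) powr (3/4) * sqrt (log 2 (log 2 (real n))))))"
proof -
  define good where "good K dec n par lab port \<longleftrightarrow> canonical_ports n par port
      \<and> (\<forall>u<n. \<forall>w<n. u \<noteq> w \<longrightarrow> dec (lab u) (lab w) = next_hop n par port u w)
      \<and> (\<forall>u<n. length (lab u) = label_bits K)"
    for K n par port and dec :: "bool list \<Rightarrow> bool list \<Rightarrow> nat" and lab
  \<comment> \<open>The decoder is fixed per \<open>K\<close>, before \<open>n\<close> and the tree;
    it receives only \<open>K\<close>, the ceiling of \<open>log 2 n\<close>.\<close>
  have "\<forall>K. \<exists>dec. \<forall>n par. is_rooted_tree n par \<longrightarrow> n \<le> 2 ^ K \<longrightarrow> (\<exists>lab port. good K dec n par lab port)"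
    unfolding good_def using ex_scheme by blast
  then obtain dec where dec: "\<And>K n par. is_rooted_tree n par \<Longrightarrow> n \<le> 2 ^ K \<Longrightarrow>
      \<exists>lab port. good K (dec K) n par lab port"
    by metis
  define enc where "enc n par = (SOME (lab, port).
      good (nat \<lceil>log 2 (real n)\<rceil>) (dec (nat \<lceil>log 2 (real n)\<rceil>)) n par lab port)" for n par
  have enc: "good (nat \<lceil>log 2 (real n)\<rceil>) (dec (nat \<lceil>log 2 (real n)\<rceil>)) n par
      (fst (enc n par)) (snd (enc n par))" if "is_rooted_tree n par" for n par
  proof -
    have "1 \<le> n" using that by (simp add: is_rooted_tree_def)
    then have "\<exists>x. case x of (lab, port) \<Rightarrow>
        good (nat \<lceil>log 2 (real n)\<rceil>) (dec (nat \<lceil>log 2 (real n)\<rceil>)) n par lab port"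
      using dec[OF that le_two_power_ceil_log] by auto
    from someI_ex[OF this] show ?thesis unfolding enc_def[symmetric] by (simp add: case_prod_beta)
  qed
  obtain C n0 where C: "\<And>n. n0 \<le> n \<Longrightarrow> real (label_bits (nat \<lceil>log 2 (real n)\<rceil>))
      \<le> log 2 (real n) + C * log 2 (real n) powr (3/4) * sqrt (log 2 (log 2 (real n)))"
    using label_bits_asymptotic by blast
  show ?thesis
  proof (rule exI[of _ enc], rule exI[of _ dec], rule exI[of _ C], rule exI[of _ n0], intro allI impI)
    fix n par assume "is_rooted_tree n par"
    note g = enc[OF this, unfolded good_def]
    show "let lab = fst (enc n par); port = snd (enc n par) in
          canonical_ports n par port
        \<and> (\<forall>u<n. \<forall>w<n. u \<noteq> w \<longrightarrow>
              dec (nat \<lceil>log 2 (real n)\<rceil>) (lab u) (lab w) = next_hop n par port u w)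
        \<and> (n0 \<le> n \<longrightarrow> (\<forall>u<n. real (length (lab u))
              \<le> log 2 (real n) + C * (log 2 (real n)) powr (3/4) * sqrt (log 2 (log 2 (real n)))))"
      unfolding Let_def using g C by simp
  qed
qed

end
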